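(* Let $a,b$ be real numbers with $a\ge 0$, $2a+b\ge 0$, and let $\psi,\phi$ be symmetric nonnegative functions on pairs of positive integers (not depending on $N$) such that $$\psi(i,j)=a(i+j)+b\quad (i,j\ge 1),\qquad \sum_{1\le i\le j:\ i+j=k}\phi(i,j)=\phi(1,1)(k-1)\quad (k\ge 1).$$ For $N\ge 1$ consider the mean-field coagulation-fragmentation process $CFP(N)$ with rates of single transitions $\psi,\phi$, assumed ergodic, with state transition rates $K,F$, and put $$\mu_{r,N}=\frac{r-1}{2}\,(2aN+rb)\ \ (2\le r\le N),\qquad \lambda_{r,N}=\phi(1,1)(N-r)\ \ (1\le r\le N-1).$$ For each $r=1,\dots,N$ let $\rho_r=\rho_{N,r}$ be a probability distribution on $\Omega_{N,r}$ such that for all $r=1,\dots,N-1$ $$\mu_{r+1,N}\,\rho_r(\eta)=\sum_{\zeta\in\Omega_{N,r+1}:\ \zeta\sim\eta}\rho_{r+1}(\zeta)K(\zeta\to\eta),\quad \eta\in\Omega_{N,r},\qquad (\mathrm{A})$$ $$\lambda_{r,N}\,\rho_{r+1}(\zeta)=\sum_{\eta\in\Omega_{N,r}:\ \eta\sim\zeta}\rho_{r}(\eta)F(\eta\to\zeta),\quad \zeta\in\Omega_{N,r+1}.\qquad (\mathrm{B})$$ Let $\rho$ be any probability distribution on $\Omega_N$ of the form $\rho(\eta)=w_r\,\rho_r(\eta)$ for $\eta\in\Omega_{N,r}$, $r=1,\dots,N$, where $w_r\ge 0$ and $\sum_{r=1}^N w_r=1$. Then the process $X_N^{(\rho)}(t)$,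 $t\ge0$, with initial distribution $\rho$ satisfies $$\mathbb{P}\big(X_N^{(\rho)}(t)=\eta\big)=\rho_r(\eta)\,b(r,\rho;t),\qquad \eta\in\Omega_{N,r},\ r=1,\dots,N,\ t\ge 0,$$ where $b(r,\rho;t)=\mathbb{P}(|X_N^{(\rho)}(t)|=r)$ are the transition probabilities of the time homogeneous birth and death process $|X_N^{(\rho)}(t)|$ on $\{1,\dots,N\}$ with birth rates $\lambda_{r,N}$, death rates $\mu_{r,N}$ and initial distribution $(w_r)_{r=1}^N$. In particular: (1) If the rates of single coagulations are positive ($\psi(i,j)>0$ for all $i,j\ge1$, i.e. $a\ge 0$, $2a+b>0$), then $$\rho_r(\eta)=\frac{1}{B_{N,r}}\prod_{k=1}^N\frac{a_k^{n_k}}{n_k!},\quad \eta=(n_1,\dots,n_N)\in\Omega_{N,r},\ r=1,\dots,N,\qquad (\mathrm{C})$$ where $$a_1=1,\quad a_k=\frac{1}{k!}\prod_{r=2}^k\Big(ka+\frac{br}{2}\Big)\ (k\ge2),\qquad B_{N,r}=\frac{\prod_{l=r+1}^N\frac{l-1}{2}(2aN+lb)}{N!\,(N-r)!}\ (1\le r\le N)$$ (an empty product being $1$). (2) In the case of pure fragmentation ($\psi\equiv 0$, $\phi(1,1)>0$), let $a',b'$ be real constants with $a'\ge0$, $2a'+b'>0$, and let $a_k$, $B_{N,r}$ be given by the formulas in (1) with $(a,b)$ replaced by $(a',b')$. Then the distributions $\rho_r=\rho_{N,r}$ satisfying (B) are given by (C) (for all $N\ge1$ and $1\le r\le N$) if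 and only if $$\phi(i,j)=\phi(1,1)\,\frac{a_ia_j}{a_{i+j}}\,\big(a'(i+j)+b'\big)\ \ (i\ne j),\qquad \phi(i,i)=\phi(1,1)\,\frac{a_i^2}{2a_{2i}}\,\big(2a'i+b'\big)$$ for all $i,j\ge1$.
   Context: For $N\ge1$, $\Omega_N$ is the set of all partitions of $N$, i.e. vectors $\eta=(n_1,\dots,n_N)$ of nonnegative integers with $\sum_{i=1}^N i n_i=N$ ($n_i$ is the number of groups of size $i$). Write $|\eta|=\sum_i n_i$ and $\Omega_{N,r}=\{\eta\in\Omega_N:|\eta|=r\}$. For $\eta\in\Omega_N$, $\eta^{(i,j)}$ denotes the partition obtained from $\eta$ by merging (coagulating) a group of size $i$ and a group of size $j$ into one of size $i+j$; $\eta_{(i,j)}$ denotes the partition obtained from $\eta$ by splitting (fragmenting) a group of size $i+j$ into groups of sizes $i$ and $j$. Two states are neighbours, $\tilde\eta\sim\eta$, if one is obtained from the other by a single coagulation or a single fragmentation. Given symmetric nonnegative functions $\psi(i,j)$ (rates of single coagulations) and $\phi(i,j)$ (rates of single fragmentations), not depending on $N$, the mean-field coagulation-fragmentation process $CFP(N)$ is the continuous-time, time homogeneous Markov chain on $\Omega_N$ with transition rates $$K(\eta\to\eta^{(i,j)})=n_in_j\psi(i,j)\ (i\ne j),\quad K(\eta\to\eta^{(i,i)})=\tfrac{n_i(n_i-1)}{2}\psi(i,i),\quad F(\eta\to\eta_{(i,j)})=n_{i+j}\phi(i,j),$$ for $2\le i+j\le N$; $K$ and $F$ are zero for pairs of states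 not related by a coagulation, respectively a fragmentation. $X_N^{(\rho)}(t)$ denotes this process started from the probability distribution $\rho$ on $\Omega_N$, and $|X_N^{(\rho)}(t)|$ is the total number of groups at time $t$. "Ergodic" means that the law of $X_N^{(\rho)}(t)$ converges as $t\to\infty$ to a limit not depending on $\rho$ (absorbing states, as in pure coagulation or pure fragmentation, are allowed). *)

theory Defs
  imports "HOL-Probability.Probability"
begin

text \<open>
  The rates are \<open>q x y\<close> for \<open>x \<noteq> y\<close>; the values \<open>q x x\<close> are irrelevant, and the behaviour of
  \<open>P h x x\<close> as \<open>h\<close> tends to \<open>0\<close> follows from the row sums.
\<close>

definition transition_function ::
  "'s set \<Rightarrow> ('s \<Rightarrow> 's \<Rightarrow> real) \<Rightarrow> (real \<Rightarrow> 's \<Rightarrow> 's \<Rightarrow> real) \<Rightarrow> bool" where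
  "transition_function S q P \<longleftrightarrow>
     finite S \<and>
     (\<forall>t\<ge>0. \<forall>x\<in>S. (\<forall>y\<in>S. 0 \<le> P t x y) \<and> (\<Sum>y\<in>S. P t x y) = 1) \<and>
     (\<forall>x\<in>S. \<forall>y\<in>S. P 0 x y = (if x = y then 1 else 0)) \<and>
     (\<forall>s\<ge>0. \<forall>t\<ge>0. \<forall>x\<in>S. \<forall>y\<in>S. P (s + t) x y = (\<Sum>z\<in>S. P s x z * P t z y)) \<and>
     (\<forall>x\<in>S. \<forall>y\<in>S. x \<noteq> y \<longrightarrow> ((\<lambda>h. P h x y / h) \<longlongrightarrow> q x y) (at_right 0))"

text \<open>
  Only finite-dimensional distributions are constrained; no regularity of sample paths is
  imposed. The values \<open>X t\<close> for \<open>t < 0\<close> are irrelevant.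
\<close>

definition markov_chain ::
  "'w measure \<Rightarrow> 's set \<Rightarrow> ('s \<Rightarrow> 's \<Rightarrow> real) \<Rightarrow> 's pmf \<Rightarrow> (real \<Rightarrow> 'w \<Rightarrow> 's) \<Rightarrow> bool" where
  "markov_chain M S q \<rho> X \<longleftrightarrow>
     prob_space M \<and>
     (\<forall>t\<ge>0. X t \<in> measurable M (count_space S)) \<and>
     set_pmf \<rho> \<subseteq> S \<and>
     (\<forall>x\<in>S. \<P>(\<omega> in M. X 0 \<omega> = x) = pmf \<rho> x) \<and>
     (\<exists>P. transition_function S q P \<and>
        (\<forall>(n::nat) (\<tau>::nat \<Rightarrow> real) (x::nat \<Rightarrow> 's) s. \<forall>y\<in>S.
           0 \<le> \<tau> 0 \<and> (\<forall>i<n. \<tau> i < \<tau> (Suc i)) \<and> \<tau> n \<le> s \<and> (\<forall>i\<le>n. x i \<in> S) \<and>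
           0 < \<P>(\<omega> in M. \<forall>i\<le>n. X (\<tau> i) \<omega> = x i) \<longrightarrow>
           \<P>(\<omega> in M. X s \<omega> = y \<bar> \<forall>i\<le>n. X (\<tau> i) \<omega> = x i) = P (s - \<tau> n) (x n) y))"

text \<open>
  Convergence of the law \<open>\<Sum>x. \<rho> x * P t x y\<close> of the chain to a limit independent of the
  initial distribution \<open>\<rho>\<close>; absorbing states are allowed. For given rates \<open>P\<close> is unique on \<open>S\<close>.
\<close>

definition ergodic_rates :: "'s set \<Rightarrow> ('s \<Rightarrow> 's \<Rightarrow> real) \<Rightarrow> bool" where
  "ergodic_rates S q \<longleftrightarrow>
     (\<exists>P \<pi>. transition_function S q P \<and>
        (\<forall>\<rho>. set_pmf \<rho> \<subseteq> S \<longrightarrow>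
           (\<forall>y\<in>S. ((\<lambda>t. \<Sum>x\<in>S. pmf \<rho> x * P t x y) \<longlongrightarrow> \<pi> y) at_top)))"

definition birth_death_rate :: "(nat \<Rightarrow> real) \<Rightarrow> (nat \<Rightarrow> real) \<Rightarrow> nat \<Rightarrow> nat \<Rightarrow> real" where
  "birth_death_rate birth death r s =
     (if s = r + 1 then birth r else if r = s + 1 then death r else 0)"

text \<open>A vector \<open>(n\<^sub>1, \<dots>, n\<^sub>N)\<close> is a function vanishing outside \<open>{1..N}\<close>.\<close>

definition Omega :: "nat \<Rightarrow> (nat \<Rightarrow> nat) set" where
  "Omega N = {\<eta>. (\<forall>i. i \<notin> {1..N} \<longrightarrow> \<eta> i = 0) \<and> (\<Sum>i=1..N. i * \<eta> i) = N}"

definition groups :: "nat \<Rightarrow> (nat \<Rightarrow> nat) \<Rightarrow> nat" where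
  "groups N \<eta> = (\<Sum>i=1..N. \<eta> i)"

definition Omega_groups :: "nat \<Rightarrow> nat \<Rightarrow> (nat \<Rightarrow> nat) set" where
  "Omega_groups N r = {\<eta> \<in> Omega N. groups N \<eta> = r}"

definition can_coag :: "nat \<Rightarrow> nat \<Rightarrow> (nat \<Rightarrow> nat) \<Rightarrow> bool" where
  "can_coag i j \<eta> \<longleftrightarrow> 1 \<le> i \<and> 1 \<le> j \<and> (if i = j then 2 \<le> \<eta> i else 1 \<le> \<eta> i \<and> 1 \<le> \<eta> j)"

definition coag :: "nat \<Rightarrow> nat \<Rightarrow> (nat \<Rightarrow> nat) \<Rightarrow> nat \<Rightarrow> nat" where
  "coag i j \<eta> = (\<lambda>k. \<eta> k - of_bool (k = i) - of_bool (k = j) + of_bool (k = i + j))"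

definition can_frag :: "nat \<Rightarrow> nat \<Rightarrow> (nat \<Rightarrow> nat) \<Rightarrow> bool" where
  "can_frag i j \<eta> \<longleftrightarrow> 1 \<le> i \<and> 1 \<le> j \<and> 1 \<le> \<eta> (i + j)"

definition frag :: "nat \<Rightarrow> nat \<Rightarrow> (nat \<Rightarrow> nat) \<Rightarrow> nat \<Rightarrow> nat" where
  "frag i j \<eta> = (\<lambda>k. \<eta> k - of_bool (k = i + j) + of_bool (k = i) + of_bool (k = j))"

definition single_step :: "(nat \<Rightarrow> nat) \<Rightarrow> (nat \<Rightarrow> nat) \<Rightarrow> bool" where
  "single_step \<eta> \<zeta> \<longleftrightarrow>
     (\<exists>i j. (can_coag i j \<eta> \<and> \<zeta> = coag i j \<eta>) \<or> (can_frag i j \<eta> \<and> \<zeta> = frag i j \<eta>))"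

definition neighbours :: "(nat \<Rightarrow> nat) \<Rightarrow> (nat \<Rightarrow> nat) \<Rightarrow> bool" where
  "neighbours \<eta> \<zeta> \<longleftrightarrow> single_step \<eta> \<zeta> \<or> single_step \<zeta> \<eta>"

text \<open>
  The states \<open>\<eta>\<close> and \<open>\<zeta>\<close> determine the unordered pair of sizes involved in a transition, so
  each of the two sums over \<open>i \<le> j\<close> below has at most one term.
\<close>

definition coag_rate :: "nat \<Rightarrow> (nat \<Rightarrow> nat \<Rightarrow> real) \<Rightarrow> (nat \<Rightarrow> nat) \<Rightarrow> (nat \<Rightarrow> nat) \<Rightarrow> real" where
  "coag_rate N \<psi> \<eta> \<zeta> =
     (\<Sum>(i, j) \<in> {(i, j). 1 \<le> i \<and> i \<le> j \<and> i + j \<le> N \<and> can_coag i j \<eta> \<and> \<zeta> = coag i j \<eta>}.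
        if i = j then real (\<eta> i) * (real (\<eta> i) - 1) / 2 * \<psi> i i
        else real (\<eta> i) * real (\<eta> j) * \<psi> i j)"

definition frag_rate :: "nat \<Rightarrow> (nat \<Rightarrow> nat \<Rightarrow> real) \<Rightarrow> (nat \<Rightarrow> nat) \<Rightarrow> (nat \<Rightarrow> nat) \<Rightarrow> real" where
  "frag_rate N \<phi> \<eta> \<zeta> =
     (\<Sum>(i, j) \<in> {(i, j). 1 \<le> i \<and> i \<le> j \<and> i + j \<le> N \<and> can_frag i j \<eta> \<and> \<zeta> = frag i j \<eta>}.
        real (\<eta> (i + j)) * \<phi> i j)"

definition cfp_rate ::
  "nat \<Rightarrow> (nat \<Rightarrow> nat \<Rightarrow> real) \<Rightarrow> (nat \<Rightarrow> nat \<Rightarrow> real) \<Rightarrow> (nat \<Rightarrow> nat) \<Rightarrow> (nat \<Rightarrow> nat) \<Rightarrow> real" where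
  "cfp_rate N \<psi> \<phi> \<eta> \<zeta> = coag_rate N \<psi> \<eta> \<zeta> + frag_rate N \<phi> \<eta> \<zeta>"

definition cfp_ergodic :: "nat \<Rightarrow> (nat \<Rightarrow> nat \<Rightarrow> real) \<Rightarrow> (nat \<Rightarrow> nat \<Rightarrow> real) \<Rightarrow> bool" where
  "cfp_ergodic N \<psi> \<phi> \<longleftrightarrow> ergodic_rates (Omega N) (cfp_rate N \<psi> \<phi>)"

definition is_cfp ::
  "'w measure \<Rightarrow> nat \<Rightarrow> (nat \<Rightarrow> nat \<Rightarrow> real) \<Rightarrow> (nat \<Rightarrow> nat \<Rightarrow> real) \<Rightarrow> (nat \<Rightarrow> nat) pmf \<Rightarrow>
   (real \<Rightarrow> 'w \<Rightarrow> nat \<Rightarrow> nat) \<Rightarrow> bool" where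
  "is_cfp M N \<psi> \<phi> \<rho> X \<longleftrightarrow> markov_chain M (Omega N) (cfp_rate N \<psi> \<phi>) \<rho> X"

definition mu :: "real \<Rightarrow> real \<Rightarrow> nat \<Rightarrow> nat \<Rightarrow> real" where
  "mu a b N r = (real r - 1) / 2 * (2 * a * real N + real r * b)"

definition lambda :: "(nat \<Rightarrow> nat \<Rightarrow> real) \<Rightarrow> nat \<Rightarrow> nat \<Rightarrow> real" where
  "lambda \<phi> N r = \<phi> 1 1 * (real N - real r)"

definition layer_distributions :: "nat \<Rightarrow> (nat \<Rightarrow> (nat \<Rightarrow> nat) pmf) \<Rightarrow> bool" where
  "layer_distributions N \<rho> \<longleftrightarrow> (\<forall>r\<in>{1..N}. set_pmf (\<rho> r) \<subseteq> Omega_groups N r)"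

definition coag_balance ::
  "real \<Rightarrow> real \<Rightarrow> (nat \<Rightarrow> nat \<Rightarrow> real) \<Rightarrow> nat \<Rightarrow> (nat \<Rightarrow> (nat \<Rightarrow> nat) pmf) \<Rightarrow> bool" where
  "coag_balance a b \<psi> N \<rho> \<longleftrightarrow>
     (\<forall>r\<in>{1..<N}. \<forall>\<eta>\<in>Omega_groups N r.
        mu a b N (r + 1) * pmf (\<rho> r) \<eta> =
        (\<Sum>\<zeta> \<in> {\<zeta> \<in> Omega_groups N (r + 1). neighbours \<zeta> \<eta>}.
           pmf (\<rho> (r + 1)) \<zeta> * coag_rate N \<psi> \<zeta> \<eta>))"

definition frag_balance ::
  "(nat \<Rightarrow> nat \<Rightarrow> real) \<Rightarrow> nat \<Rightarrow> (nat \<Rightarrow> (nat \<Rightarrow> nat) pmf) \<Rightarrow> bool" where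
  "frag_balance \<phi> N \<rho> \<longleftrightarrow>
     (\<forall>r\<in>{1..<N}. \<forall>\<zeta>\<in>Omega_groups N (r + 1).
        lambda \<phi> N r * pmf (\<rho> (r + 1)) \<zeta> =
        (\<Sum>\<eta> \<in> {\<eta> \<in> Omega_groups N r. neighbours \<eta> \<zeta>}.
           pmf (\<rho> r) \<eta> * frag_rate N \<phi> \<eta> \<zeta>))"

text \<open>For \<open>k = 1\<close> the product is empty and the value is \<open>1\<close>.\<close>

definition gibbs_weight :: "real \<Rightarrow> real \<Rightarrow> nat \<Rightarrow> real" where
  "gibbs_weight a b k = 1 / fact k * (\<Prod>r=2..k. real k * a + b * real r / 2)"

definition gibbs_norm :: "real \<Rightarrow> real \<Rightarrow> nat \<Rightarrow> nat \<Rightarrow> real" where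
  "gibbs_norm a b N r =
     (\<Prod>l=r+1..N. (real l - 1) / 2 * (2 * a * real N + real l * b)) / (fact N * fact (N - r))"

definition gibbs_layers :: "real \<Rightarrow> real \<Rightarrow> nat \<Rightarrow> (nat \<Rightarrow> (nat \<Rightarrow> nat) pmf) \<Rightarrow> bool" where
  "gibbs_layers a b N \<rho> \<longleftrightarrow>
     (\<forall>r\<in>{1..N}. \<forall>\<eta>\<in>Omega_groups N r.
        pmf (\<rho> r) \<eta> =
        1 / gibbs_norm a b N r * (\<Prod>k=1..N. gibbs_weight a b k ^ \<eta> k / fact (\<eta> k)))"

end

theory Submission imports Defs begin

text \<open>
  The total coagulation and fragmentation rates of a state depend on its number of groups only,
  so the number of groups is a lumping of the process with generator \<open>Q\<close>. Conditions (A) and (B)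
  say that the projection \<open>\<Pi>(\<eta>, \<zeta>) = \<rho>\<^sub>r(\<zeta>)\<close>, \<open>r = |\<eta>|\<close>, commutes with \<open>Q\<close>; hence it
  commutes with the transition matrices, which gives the product form and the Markov property of
  the number of groups.

  The unnormalised Gibbs measure \<open>W(\<eta>) = \<Prod>\<^sub>k a\<^sub>k\<^bsup>n\<^sub>k\<^esup> / n\<^sub>k!\<close> satisfies detailed balance between the
  coagulation kernel \<open>a(i + j) + b\<close> and the fragmentation kernel
  \<open>a\<^sub>i a\<^sub>j (a(i + j) + b) / a\<^bsub>i+j\<^esub>\<close> (halved for \<open>i = j\<close>), whose total rate on groups of size \<open>k\<close> is
  \<open>k - 1\<close> by the Rothe--Hagen identity. Summing detailed balance over either endpoint gives (A)
  and (B) for the Gibbs layers. Conversely (A) determines the layers downwards from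
  \<open>\<Omega>\<^bsub>N,N\<^esub>\<close> and (B) upwards from \<open>\<Omega>\<^bsub>N,1\<^esub>\<close>, both of which are singletons; comparing the layers
  \<open>r = 1, 2\<close> for \<open>N = i + j\<close> recovers \<open>\<phi>(i, j)\<close>.
\<close>

section \<open>Lumping of finite Markov chains\<close>

text \<open>A chain provides its transition matrices only through stochasticity, the semigroup law
  and the rates at time 0+, so commutation is carried from the generator to all times without
  Kolmogorov equations or a matrix exponential. The projection first forgets everything but the
  layer and then resamples inside it. One commutation therefore contains both the classical
  lumpability criterion and the intertwining of the two chains.

  In part (2) the coagulation kernel built from \<open>a'\<close> and \<open>b'\<close> is
  fictitious: it is the time reversal of a fragmentation kernel and not a rate of the process. The
  "only if" direction speaks about all solutions of (B), so it would be empty without a proof that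
  (B) has solutions. The Rothe--Hagen argument moves in steps of length b / 2 and breaks down for b
  = 0, where the identity becomes one of Abel type and is reached by continuity in b.\<close>

definition generator :: "'s set \<Rightarrow> ('s \<Rightarrow> 's \<Rightarrow> real) \<Rightarrow> 's \<Rightarrow> 's \<Rightarrow> real" where
  "generator S q x y = (if x = y then - (\<Sum>z\<in>S - {x}. q x z) else q x y)"

lemma
  assumes "transition_function S q P"
  shows transition_function_finite: "finite S"
    and transition_function_nonneg: "0 \<le> t \<Longrightarrow> x \<in> S \<Longrightarrow> y \<in> S \<Longrightarrow> 0 \<le> P t x y"
    and transition_function_sum: "0 \<le> t \<Longrightarrow> x \<in> S \<Longrightarrow> (\<Sum>y\<in>S. P t x y) = 1"
    and transition_function_zero: "x \<in> S \<Longrightarrow> y \<in> S \<Longrightarrow> P 0 x y = (if x = y then 1 else 0)"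
    and transition_function_add: "0 \<le> s \<Longrightarrow> 0 \<le> t \<Longrightarrow> x \<in> S \<Longrightarrow> y \<in> S \<Longrightarrow>
          P (s + t) x y = (\<Sum>z\<in>S. P s x z * P t z y)"
    and transition_function_rate: "x \<in> S \<Longrightarrow> y \<in> S \<Longrightarrow> x \<noteq> y \<Longrightarrow>
          ((\<lambda>h. P h x y / h) \<longlongrightarrow> q x y) (at_right 0)"
  using assms unfolding transition_function_def by simp_all

text \<open>The rates prescribe only off-diagonal derivatives at 0; the row sums supply the
  diagonal. With P'(0+) = Q in all entries, sums of products can be differentiated
  uniformly.\<close>

lemma transition_function_generator:
  assumes P: "transition_function S q P" and x: "x \<in> S" and y: "y \<in> S"
  shows "((\<lambda>h. (P h x y - of_bool (x = y)) / h) \<longlongrightarrow> generator S q x y) (at_right 0)"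
proof (cases "x = y")
  case False
  then show ?thesis
    using transition_function_rate[OF P x y] by (simp add: generator_def)
next
  case True
  have fin: "finite S" by (rule transition_function_finite[OF P])
  have "((\<lambda>h. - (\<Sum>z\<in>S - {x}. P h x z / h)) \<longlongrightarrow> - (\<Sum>z\<in>S - {x}. q x z)) (at_right 0)"
    by (intro tendsto_minus tendsto_sum transition_function_rate[OF P x]) auto
  moreover have "\<forall>\<^sub>F h in at_right 0.
      - (\<Sum>z\<in>S - {x}. P h x z / h) = (P h x y - of_bool (x = y)) / h"
  proof (rule eventually_at_right_less[THEN eventually_mono])
    fix h :: real assume h: "0 < h"
    have "(\<Sum>z\<in>S. P h x z) = P h x x + (\<Sum>z\<in>S - {x}. P h x z)"
      using fin x by (simp add: sum.remove)
    then show "- (\<Sum>z\<in>S - {x}. P h x z / h) = (P h x y - of_bool (x = y)) / h"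
      using transition_function_sum[OF P _ x, of h] h True
      by (simp add: field_simps flip: sum_divide_distrib)
  qed
  ultimately show ?thesis
    using True by (auto simp: generator_def intro: Lim_transform_eventually)
qed

text \<open>
  The commutator \<open>C\<close> of \<open>P t\<close> with \<open>R\<close> satisfies \<open>C (s + t) = P s * C t + C s * P t\<close>, so its
  maximal absolute row sum is subadditive in \<open>t\<close>; it is \<open>o(t)\<close> because the generator commutes
  with \<open>R\<close>, hence it vanishes.
\<close>

lemma transition_function_commute:
  fixes R :: "'s \<Rightarrow> 's \<Rightarrow> real"
  assumes P: "transition_function S q P"
    and comm: "\<And>x y. x \<in> S \<Longrightarrow> y \<in> S \<Longrightarrow>
      (\<Sum>z\<in>S. generator S q x z * R z y) = (\<Sum>z\<in>S. R x z * generator S q z y)"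
    and t: "0 \<le> t" and x: "x \<in> S" and y: "y \<in> S"
  shows "(\<Sum>z\<in>S. P t x z * R z y) = (\<Sum>z\<in>S. R x z * P t z y)"
proof -
  have fin: "finite S" by (rule transition_function_finite[OF P])
  define C where "C t x y = (\<Sum>z\<in>S. P t x z * R z y) - (\<Sum>z\<in>S. R x z * P t z y)" for t x y
  have C_add: "C (s + t) x y = (\<Sum>z\<in>S. P s x z * C t z y) + (\<Sum>z\<in>S. C s x z * P t z y)"
    if "0 \<le> s" "0 \<le> t" "x \<in> S" "y \<in> S" for s t x y
  proof -
    have 1: "(\<Sum>z\<in>S. P (s + t) x z * R z y) = (\<Sum>u\<in>S. P s x u * (\<Sum>z\<in>S. P t u z * R z y))"
      using that by (subst sum_distrib_left, subst sum.swap)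
        (simp add: transition_function_add[OF P] sum_distrib_right mult.assoc)
    have 2: "(\<Sum>z\<in>S. R x z * P (s + t) z y) = (\<Sum>u\<in>S. (\<Sum>z\<in>S. R x z * P s z u) * P t u y)"
      using that by (subst sum_distrib_right, subst sum.swap)
        (simp add: transition_function_add[OF P] sum_distrib_left mult.assoc)
    have 3: "(\<Sum>u\<in>S. P s x u * (\<Sum>z\<in>S. R u z * P t z y)) = (\<Sum>u\<in>S. (\<Sum>z\<in>S. P s x z * R z u) * P t u y)"
      by (simp only: sum_distrib_left sum_distrib_right mult.assoc, subst sum.swap) (rule refl)
    have 4: "(\<Sum>u\<in>S. P s x u * C t u y) =
        (\<Sum>u\<in>S. P s x u * (\<Sum>z\<in>S. P t u z * R z y)) - (\<Sum>u\<in>S. P s x u * (\<Sum>z\<in>S. R u z * P t z y))"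
      by (simp only: C_def right_diff_distrib sum_subtractf)
    have 5: "(\<Sum>u\<in>S. C s x u * P t u y) =
        (\<Sum>u\<in>S. (\<Sum>z\<in>S. P s x z * R z u) * P t u y) - (\<Sum>u\<in>S. (\<Sum>z\<in>S. R x z * P s z u) * P t u y)"
      by (simp only: C_def left_diff_distrib sum_subtractf)
    show ?thesis
      unfolding 4 5 3 by (simp add: C_def 1 2)
  qed
  have C_row_add: "(\<Sum>y\<in>S. \<bar>C (s + t) x y\<bar>) \<le> c + d"
    if st: "0 \<le> s" "0 \<le> t" and x: "x \<in> S"
      and c: "\<And>x. x \<in> S \<Longrightarrow> (\<Sum>y\<in>S. \<bar>C s x y\<bar>) \<le> c"
      and d: "\<And>x. x \<in> S \<Longrightarrow> (\<Sum>y\<in>S. \<bar>C t x y\<bar>) \<le> d" for s t x c d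
  proof -
    have "(\<Sum>y\<in>S. \<bar>C (s + t) x y\<bar>) \<le>
        (\<Sum>y\<in>S. (\<Sum>z\<in>S. P s x z * \<bar>C t z y\<bar>) + (\<Sum>z\<in>S. \<bar>C s x z\<bar> * P t z y))"
    proof (rule sum_mono)
      fix y assume y: "y \<in> S"
      have "\<bar>C (s + t) x y\<bar> \<le> \<bar>\<Sum>z\<in>S. P s x z * C t z y\<bar> + \<bar>\<Sum>z\<in>S. C s x z * P t z y\<bar>"
        unfolding C_add[OF st x y] by (rule abs_triangle_ineq)
      also have "\<dots> \<le> (\<Sum>z\<in>S. \<bar>P s x z * C t z y\<bar>) + (\<Sum>z\<in>S. \<bar>C s x z * P t z y\<bar>)"
        by (intro add_mono sum_abs)
      also have "\<dots> = (\<Sum>z\<in>S. P s x z * \<bar>C t z y\<bar>) + (\<Sum>z\<in>S. \<bar>C s x z\<bar> * P t z y)"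
        using st x y by (simp add: abs_mult transition_function_nonneg[OF P])
      finally show "\<bar>C (s + t) x y\<bar> \<le> (\<Sum>z\<in>S. P s x z * \<bar>C t z y\<bar>) + (\<Sum>z\<in>S. \<bar>C s x z\<bar> * P t z y)" .
    qed
    also have "\<dots> = (\<Sum>z\<in>S. P s x z * (\<Sum>y\<in>S. \<bar>C t z y\<bar>)) + (\<Sum>z\<in>S. \<bar>C s x z\<bar> * (\<Sum>y\<in>S. P t z y))"
      unfolding sum.distrib sum_distrib_left
      by (rule arg_cong2[of _ _ _ _ "(+)"]; rule sum.swap)
    also have "\<dots> \<le> (\<Sum>z\<in>S. P s x z * d) + (\<Sum>z\<in>S. \<bar>C s x z\<bar>)"
      using st x d by (intro add_mono sum_mono mult_left_mono)
        (auto simp: transition_function_nonneg[OF P] transition_function_sum[OF P])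
    also have "\<dots> \<le> d + c"
      using c[OF x] st x by (simp add: transition_function_sum[OF P] flip: sum_distrib_right)
    finally show ?thesis by simp
  qed
  have C_zero: "C 0 x y = 0" if "x \<in> S" "y \<in> S" for x y
    using that fin by (simp add: C_def transition_function_zero[OF P] if_distrib if_distribR
        sum.delta sum.delta' cong: if_cong)
  have C_row_mult: "(\<Sum>y\<in>S. \<bar>C (real n * s) x y\<bar>) \<le> real n * c"
    if s: "0 \<le> s" and x: "x \<in> S" and c: "\<And>x. x \<in> S \<Longrightarrow> (\<Sum>y\<in>S. \<bar>C s x y\<bar>) \<le> c" for n s x c
    using x
  proof (induction n arbitrary: x)
    case 0
    then show ?case by (simp add: C_zero)
  next
    case (Suc n)
    have "(\<Sum>y\<in>S. \<bar>C (s + real n * s) x y\<bar>) \<le> c + real n * c"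
      using s Suc.prems by (intro C_row_add c Suc.IH) auto
    then show ?case by (simp add: algebra_simps)
  qed
  have C_lim: "((\<lambda>h. C h x y / h) \<longlongrightarrow> 0) (at_right 0)" if x: "x \<in> S" and y: "y \<in> S" for x y
  proof -
    have "C h x y / h = (\<Sum>z\<in>S. (P h x z - of_bool (x = z)) / h * R z y)
        - (\<Sum>z\<in>S. R x z * ((P h z y - of_bool (z = y)) / h))" for h
    proof -
      have "(\<Sum>z\<in>S. of_bool (x = z) * R z y) = R x y" "(\<Sum>z\<in>S. R x z * of_bool (z = y)) = R x y"
        using x y fin by (simp_all add: of_bool_def if_distrib if_distribR sum.delta sum.delta' cong: if_cong)
      then have C: "C h x y = (\<Sum>z\<in>S. (P h x z - of_bool (x = z)) * R z y)
        - (\<Sum>z\<in>S. R x z * (P h z y - of_bool (z = y)))"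
        by (simp add: C_def sum_subtractf left_diff_distrib right_diff_distrib)
      show ?thesis
        unfolding C diff_divide_distrib[of "sum _ _"] sum_divide_distrib by simp
    qed
    moreover have "((\<lambda>h. (\<Sum>z\<in>S. (P h x z - of_bool (x = z)) / h * R z y)
        - (\<Sum>z\<in>S. R x z * ((P h z y - of_bool (z = y)) / h))) \<longlongrightarrow>
        (\<Sum>z\<in>S. generator S q x z * R z y) - (\<Sum>z\<in>S. R x z * generator S q z y)) (at_right 0)"
      using x y by (intro tendsto_intros transition_function_generator[OF P]) auto
    ultimately show ?thesis using comm[OF x y] by simp
  qed
  \<comment> \<open>The limit is uniform in the starting state because \<open>S\<close> is finite.
    Then t is cut into n equal pieces of length h below \<delta>, and n copies of the bound e h add
    up to e t.\<close>
  have small: "(\<Sum>y\<in>S. \<bar>C t x y\<bar>) \<le> e * t" if "0 < t" "0 < e" for e t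
  proof -
    have "\<forall>\<^sub>F h in at_right 0. \<forall>x\<in>S. (\<Sum>y\<in>S. \<bar>C h x y / h\<bar>) < e"
    proof (rule eventually_ball_finite[OF fin], intro ballI)
      fix x assume "x \<in> S"
      then have "((\<lambda>h. \<Sum>y\<in>S. \<bar>C h x y / h\<bar>) \<longlongrightarrow> (\<Sum>y\<in>S. \<bar>0\<bar>)) (at_right 0)"
        by (intro tendsto_sum tendsto_rabs C_lim)
      then show "\<forall>\<^sub>F h in at_right 0. (\<Sum>y\<in>S. \<bar>C h x y / h\<bar>) < e"
        using \<open>0 < e\<close> by (auto dest: order_tendstoD(2))
    qed
    then obtain \<delta> where \<delta>: "0 < \<delta>" "\<And>h x. 0 < h \<Longrightarrow> h < \<delta> \<Longrightarrow> x \<in> S \<Longrightarrow> (\<Sum>y\<in>S. \<bar>C h x y / h\<bar>) < e"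
      by (auto simp: eventually_at_right_field)
    obtain n where n: "t / \<delta> < real n" using reals_Archimedean2 by blast
    have n0: "0 < real n" using n \<delta>(1) \<open>0 < t\<close> by (meson divide_pos_pos less_trans)
    define h where "h = t / real n"
    have h: "0 < h" "h < \<delta>" using n n0 \<delta>(1) \<open>0 < t\<close> by (simp_all add: h_def field_simps)
    have "(\<Sum>y\<in>S. \<bar>C h x y\<bar>) \<le> e * h" if "x \<in> S" for x
      using \<delta>(2)[OF h that] h(1) by (simp add: abs_divide field_simps flip: sum_divide_distrib)
    then have "(\<Sum>y\<in>S. \<bar>C (real n * h) x y\<bar>) \<le> real n * (e * h)"
      using h(1) x by (intro C_row_mult) auto
    then show ?thesis using n0 by (simp add: h_def)
  qed
  have "C t x y = 0"
  proof (cases "t = 0")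
    case True
    then show ?thesis using C_zero x y by simp
  next
    case False
    then have t: "0 < t" using t by simp
    have "(\<Sum>y\<in>S. \<bar>C t x y\<bar>) \<le> 0"
    proof (rule field_le_epsilon)
      fix e :: real assume "0 < e"
      then show "(\<Sum>y\<in>S. \<bar>C t x y\<bar>) \<le> 0 + e" using small[OF t, of "e / t"] t by simp
    qed
    moreover have "\<bar>C t x y\<bar> \<le> (\<Sum>y\<in>S. \<bar>C t x y\<bar>)"
      using fin y by (intro member_le_sum) auto
    ultimately show ?thesis by simp
  qed
  then show ?thesis by (simp add: C_def)
qed

\<comment> \<open>the simproc diverges on events that quantify over the times of a path\<close>
declare [[simproc del: measurable]]

section \<open>Finite-dimensional events of a Markov chain\<close>

lemma nonneg_if_increasing:
  fixes \<tau> :: "nat \<Rightarrow> real"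
  assumes "0 \<le> \<tau> 0" and "\<And>i. i < n \<Longrightarrow> \<tau> i < \<tau> (Suc i)" and "i \<le> n"
  shows "0 \<le> \<tau> i"
  using assms(3)
proof (induction i)
  case (Suc i)
  then show ?case using assms(2)[of i] by simp
qed (rule assms(1))

context
  fixes M :: "'w measure" and S :: "'s set" and q :: "'s \<Rightarrow> 's \<Rightarrow> real" and \<rho> X
  assumes chain: "markov_chain M S q \<rho> X"
begin

lemma markov_chain_events:
  assumes "0 \<le> t"
  shows "{\<omega> \<in> space M. X t \<omega> \<in> A} \<in> sets M"
proof -
  have X: "X t \<in> measurable M (count_space S)"
    using chain assms by (simp add: markov_chain_def)
  have "X t -` (A \<inter> S) \<inter> space M \<in> sets M"
    by (rule measurable_sets[OF X]) simp
  also have "X t -` (A \<inter> S) \<inter> space M = {\<omega> \<in> space M. X t \<omega> \<in> A}"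
    using measurable_space[OF X] by auto
  finally show ?thesis .
qed

lemma markov_chain_path_events:
  fixes n :: nat
  assumes "\<And>i. i \<le> n \<Longrightarrow> 0 \<le> \<tau> i"
  shows "{\<omega> \<in> space M. \<forall>i\<le>n. X (\<tau> i) \<omega> \<in> A i} \<in> sets M"
proof -
  have "{\<omega> \<in> space M. \<forall>i\<in>{..n}. X (\<tau> i) \<omega> \<in> A i} \<in> sets M"
  proof (rule sets.sets_Collect_finite_All)
    show "{\<omega> \<in> space M. X (\<tau> i) \<omega> \<in> A i} \<in> sets M" if "i \<in> {..n}" for i
      by (rule markov_chain_events, rule assms) (use that in simp)
  qed simp
  then show ?thesis by (simp only: Ball_def atMost_iff)
qed

lemma markov_chain_space:
  assumes "0 \<le> t" and "\<omega> \<in> space M"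
  shows "X t \<omega> \<in> S"
proof -
  have "X t \<in> measurable M (count_space S)"
    using chain assms(1) by (simp add: markov_chain_def)
  from measurable_space[OF this assms(2)] show ?thesis by simp
qed

text \<open>Conditional probabilities are traded for joint ones. The product form also holds for a
  past of probability 0, where both sides vanish, so later sums over paths need no case distinction
  on null events.\<close>

lemma markov_chain_transition_function:
  obtains P where "transition_function S q P"
    and "\<And>n \<tau> x s y. \<lbrakk>0 \<le> \<tau> (0::nat); \<And>i. i < n \<Longrightarrow> \<tau> i < \<tau> (Suc i); \<tau> n \<le> s;
      \<And>i. i \<le> n \<Longrightarrow> x i \<in> S; y \<in> S\<rbrakk> \<Longrightarrow>
      \<P>(\<omega> in M. X s \<omega> = y \<and> (\<forall>i\<le>n. X (\<tau> i) \<omega> = x i)) =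
      \<P>(\<omega> in M. \<forall>i\<le>n. X (\<tau> i) \<omega> = x i) * P (s - \<tau> n) (x n) y"
proof -
  interpret prob_space M
    using chain by (simp add: markov_chain_def)
  obtain P where P: "transition_function S q P"
    and cond: "\<forall>(n::nat) (\<tau>::nat \<Rightarrow> real) x s. \<forall>y\<in>S.
           0 \<le> \<tau> 0 \<and> (\<forall>i<n. \<tau> i < \<tau> (Suc i)) \<and> \<tau> n \<le> s \<and> (\<forall>i\<le>n. x i \<in> S) \<and>
           0 < \<P>(\<omega> in M. \<forall>i\<le>n. X (\<tau> i) \<omega> = x i) \<longrightarrow>
           \<P>(\<omega> in M. X s \<omega> = y \<bar> \<forall>i\<le>n. X (\<tau> i) \<omega> = x i) = P (s - \<tau> n) (x n) y"
    using chain unfolding markov_chain_def by blast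
  have "\<P>(\<omega> in M. X s \<omega> = y \<and> (\<forall>i\<le>n. X (\<tau> i) \<omega> = x i)) =
      \<P>(\<omega> in M. \<forall>i\<le>n. X (\<tau> i) \<omega> = x i) * P (s - \<tau> n) (x n) y"
    if h: "0 \<le> \<tau> 0" "\<And>i. i < n \<Longrightarrow> \<tau> i < \<tau> (Suc i)" "\<tau> n \<le> s"
      "\<And>i. i \<le> n \<Longrightarrow> x i \<in> S" "y \<in> S" for n \<tau> x s y
  proof (cases "0 < \<P>(\<omega> in M. \<forall>i\<le>n. X (\<tau> i) \<omega> = x i)")
    case True
    then have "\<P>(\<omega> in M. X s \<omega> = y \<bar> \<forall>i\<le>n. X (\<tau> i) \<omega> = x i) = P (s - \<tau> n) (x n) y"
      using cond h by blast
    then show ?thesis using True by (simp add: cond_prob_def field_simps)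
  next
    case False
    then have 0: "\<P>(\<omega> in M. \<forall>i\<le>n. X (\<tau> i) \<omega> = x i) = 0"
      using measure_nonneg[of M] by (simp add: order.antisym not_less)
    have \<tau>: "0 \<le> \<tau> i" if "i \<le> n" for i
      using nonneg_if_increasing[of \<tau> n i] h(1,2) that by blast
    have "\<P>(\<omega> in M. X s \<omega> = y \<and> (\<forall>i\<le>n. X (\<tau> i) \<omega> = x i)) \<le> \<P>(\<omega> in M. \<forall>i\<le>n. X (\<tau> i) \<omega> = x i)"
    proof (rule finite_measure_mono)
      show "{\<omega> \<in> space M. \<forall>i\<le>n. X (\<tau> i) \<omega> = x i} \<in> sets M"
        using markov_chain_path_events[of n \<tau> "\<lambda>i. {x i}", OF \<tau>] by simp
    qed blast
    then show ?thesis
      using 0 measure_nonneg[of M] by (simp add: order.antisym)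
  qed
  with P show ?thesis by (rule that)
qed

end

section \<open>Lumping a chain along layers that carry prescribed laws\<close>

locale lumping =
  fixes S :: "'s set" and T :: "'r set" and g :: "'s \<Rightarrow> 'r"
    and q :: "'s \<Rightarrow> 's \<Rightarrow> real" and q' :: "'r \<Rightarrow> 'r \<Rightarrow> real" and L :: "'r \<Rightarrow> 's pmf"
  assumes finite_S: "finite S" and finite_T: "finite T"
    and g_T: "x \<in> S \<Longrightarrow> g x \<in> T"
    and L_layer: "r \<in> T \<Longrightarrow> set_pmf (L r) \<subseteq> {x \<in> S. g x = r}"
    and no_internal: "x \<in> S \<Longrightarrow> y \<in> S \<Longrightarrow> x \<noteq> y \<Longrightarrow> g x = g y \<Longrightarrow> q x y = 0"
    and lump: "x \<in> S \<Longrightarrow> s \<in> T \<Longrightarrow> s \<noteq> g x \<Longrightarrow> (\<Sum>y\<in>{y \<in> S. g y = s}. q x y) = q' (g x) s"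
    and link: "r \<in> T \<Longrightarrow> y \<in> S \<Longrightarrow> g y \<noteq> r \<Longrightarrow>
      (\<Sum>x\<in>{x \<in> S. g x = r}. pmf (L r) x * q x y) = q' r (g y) * pmf (L (g y)) y"
begin

lemma pmf_L_eq_0: "r \<in> T \<Longrightarrow> g x \<noteq> r \<Longrightarrow> pmf (L r) x = 0"
  using L_layer[of r] by (auto simp: pmf_eq_0_set_pmf)

lemma sum_layers: "(\<Sum>x\<in>S. f x) = (\<Sum>r\<in>T. \<Sum>x\<in>{x \<in> S. g x = r}. f x)" for f :: "'s \<Rightarrow> real"
  by (rule sum.group[symmetric]) (use finite_S finite_T g_T in auto)

lemma sum_pmf_L: "r \<in> T \<Longrightarrow> (\<Sum>x\<in>S. pmf (L r) x * f x) = (\<Sum>x\<in>{x \<in> S. g x = r}. pmf (L r) x * f x)"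
  by (rule sum.mono_neutral_right) (use finite_S pmf_L_eq_0 in auto)

lemma sum_pmf_L': "y \<in> S \<Longrightarrow>
    (\<Sum>x\<in>S. f x * pmf (L (g x)) y) = (\<Sum>x\<in>{x \<in> S. g x = g y}. f x) * pmf (L (g y)) y"
  unfolding sum_distrib_right
proof (rule sum.mono_neutral_cong_right)
  show "\<forall>x\<in>S - {x \<in> S. g x = g y}. f x * pmf (L (g x)) y = 0"
    using pmf_L_eq_0[OF g_T, of _ y] by fastforce
qed (auto simp: finite_S)

lemma sum_pmf_L_1: "r \<in> T \<Longrightarrow> (\<Sum>x\<in>{x \<in> S. g x = r}. pmf (L r) x) = 1"
  using L_layer finite_S by (intro sum_pmf_eq_1) auto

text \<open>Jumps inside a layer have rate 0, so the exit rate of a state is the sum of its rates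
  into the other layers, each of which depends on the layer of the state alone.\<close>

lemma generator_diag:
  assumes "x \<in> S"
  shows "generator S q x x = - (\<Sum>s\<in>T - {g x}. q' (g x) s)"
proof -
  have "(\<Sum>z\<in>S - {x}. q x z) = (\<Sum>z\<in>S. if z = x then 0 else q x z)"
    using finite_S by (intro sum.mono_neutral_cong_left) auto
  also have "\<dots> = (\<Sum>s\<in>T. if s = g x then 0 else q' (g x) s)"
    unfolding sum_layers
  proof (rule sum.cong)
    fix s assume s: "s \<in> T"
    show "(\<Sum>z\<in>{z \<in> S. g z = s}. if z = x then 0 else q x z) = (if s = g x then 0 else q' (g x) s)"
    proof (cases "s = g x")
      case True
      then show ?thesis using assms no_internal by (auto intro!: sum.neutral)
    next
      case False
      then show ?thesis
        unfolding lump[OF assms s False, symmetric] by (auto intro!: sum.cong)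
    qed
  qed simp
  also have "\<dots> = (\<Sum>s\<in>T - {g x}. q' (g x) s)"
    using finite_T by (intro sum.mono_neutral_cong_right) auto
  finally show ?thesis by (simp add: generator_def)
qed

text \<open>On the left only targets in the layer of y count, and \<open>lump\<close> evaluates
  their total rate from x; on the right only sources in the layer of x count, and
  \<open>link\<close> evaluates their averaged rate into y. Both give the rate between the layers
  times \<open>pmf (L (g y)) y\<close>. Inside one layer both sides reduce to diagonal entries,
  which agree by \<open>generator_diag\<close>.\<close>

lemma generator_commute:
  assumes x: "x \<in> S" and y: "y \<in> S"
  shows "(\<Sum>z\<in>S. generator S q x z * pmf (L (g z)) y) = (\<Sum>z\<in>S. pmf (L (g x)) z * generator S q z y)"
proof (cases "g x = g y")
  case True
  have "(\<Sum>z\<in>{z \<in> S. g z = g y}. generator S q x z) = (\<Sum>z\<in>{x}. generator S q x z)"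
    using finite_S x True no_internal by (intro sum.mono_neutral_right) (auto simp: generator_def)
  moreover have "(\<Sum>z\<in>{z \<in> S. g z = g x}. pmf (L (g x)) z * generator S q z y)
      = (\<Sum>z\<in>{y}. pmf (L (g x)) z * generator S q z y)"
    using finite_S y True no_internal by (intro sum.mono_neutral_right) (auto simp: generator_def)
  ultimately show ?thesis
    using True x y by (simp add: sum_pmf_L' sum_pmf_L g_T generator_diag)
next
  case False
  have "(\<Sum>z\<in>{z \<in> S. g z = g y}. generator S q x z) = q' (g x) (g y)"
    unfolding lump[OF x g_T[OF y] False[symmetric], symmetric]
    using False by (intro sum.cong) (auto simp: generator_def)
  moreover have "(\<Sum>z\<in>{z \<in> S. g z = g x}. pmf (L (g x)) z * generator S q z y)
     = q' (g x) (g y) * pmf (L (g y)) y"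
    unfolding link[OF g_T[OF x] y False[symmetric], symmetric]
    using False by (intro sum.cong) (auto simp: generator_def)
  ultimately show ?thesis
    using x y by (simp add: sum_pmf_L' sum_pmf_L g_T)
qed

text \<open>Averaging over \<open>L r\<close> avoids choosing a representative of the layer; by
  \<open>sum_transition_layer\<close> every state of the layer yields this value.\<close>

definition lumped :: "(real \<Rightarrow> 's \<Rightarrow> 's \<Rightarrow> real) \<Rightarrow> real \<Rightarrow> 'r \<Rightarrow> 'r \<Rightarrow> real" where
  "lumped P t r s = (\<Sum>x\<in>S. pmf (L r) x * (\<Sum>y\<in>{y \<in> S. g y = s}. P t x y))"

context
  fixes P
  assumes P: "transition_function S q P"
begin

lemma sum_transition_layer:
  assumes t: "0 \<le> t" and x: "x \<in> S" and s: "s \<in> T"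
  shows "(\<Sum>y\<in>{y \<in> S. g y = s}. P t x y) = lumped P t (g x) s"
proof -
  \<comment> \<open>The inserted factor is the total mass 1 of \<open>L s\<close>. It completes the
    sum to \<open>P t\<close> followed by the projection, to which the commutation applies.\<close>
  have "(\<Sum>y\<in>{y \<in> S. g y = s}. P t x y) = (\<Sum>y\<in>{y \<in> S. g y = s}. P t x y) * (\<Sum>y\<in>{y \<in> S. g y = s}. pmf (L s) y)"
    by (simp add: sum_pmf_L_1 s)
  also have "\<dots> = (\<Sum>y\<in>{y \<in> S. g y = s}. \<Sum>z\<in>S. P t x z * pmf (L (g z)) y)"
    unfolding sum_distrib_left by (intro sum.cong refl) (auto simp: sum_pmf_L')
  also have "\<dots> = (\<Sum>y\<in>{y \<in> S. g y = s}. \<Sum>z\<in>S. pmf (L (g x)) z * P t z y)"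
    by (rule sum.cong[OF refl], rule transition_function_commute[OF P generator_commute t x]) auto
  also have "\<dots> = lumped P t (g x) s"
    unfolding lumped_def sum_distrib_left by (rule sum.swap)
  finally show ?thesis .
qed

text \<open>The commutation is read at any state of layer r; one exists because \<open>L r\<close>
  has nonempty support. In effect \<open>P t\<close> turns \<open>L r\<close> into a mixture of the
  laws \<open>L s\<close>, the source of the product form.\<close>

lemma sum_link_transition:
  assumes t: "0 \<le> t" and r: "r \<in> T" and y: "y \<in> S"
  shows "(\<Sum>x\<in>S. pmf (L r) x * P t x y) = lumped P t r (g y) * pmf (L (g y)) y"
proof -
  obtain x where x: "x \<in> S" "g x = r"
    using L_layer[OF r] set_pmf_not_empty[of "L r"] by blast
  show ?thesis
    using transition_function_commute[OF P generator_commute t x(1) y]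
      sum_transition_layer[OF t x(1) g_T[OF y]] x(2) y by (simp add: sum_pmf_L')
qed

text \<open>Apart from nonnegativity, each property is computed at one representative of the layer,
  where \<open>lumped\<close> is a plain sum of transition probabilities.\<close>

lemma transition_function_lumped: "transition_function T q' (lumped P)"
proof -
  have rep: "\<exists>x\<in>S. g x = r" if "r \<in> T" for r
    using L_layer[OF that] set_pmf_not_empty[of "L r"] by blast
  have nonneg: "0 \<le> lumped P t r s" if "0 \<le> t" for t r s
    unfolding lumped_def using that
    by (intro sum_nonneg mult_nonneg_nonneg) (auto simp: transition_function_nonneg[OF P])
  have total: "(\<Sum>s\<in>T. lumped P t r s) = 1" if t: "0 \<le> t" and r: "r \<in> T" for t r
  proof -
    obtain x where x: "x \<in> S" "g x = r" using rep[OF r] by blast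
    have "(\<Sum>s\<in>T. lumped P t r s) = (\<Sum>y\<in>S. P t x y)"
      unfolding sum_layers using x t by (intro sum.cong) (auto simp: sum_transition_layer)
    then show ?thesis using transition_function_sum[OF P t x(1)] by simp
  qed
  have zero: "lumped P 0 r s = (if r = s then 1 else 0)" if rs: "r \<in> T" "s \<in> T" for r s
  proof -
    obtain x where x: "x \<in> S" "g x = r" using rep[OF rs(1)] by blast
    have "lumped P 0 r s = (\<Sum>y\<in>{y \<in> S. g y = s}. P 0 x y)"
      using x rs by (simp add: sum_transition_layer)
    also have "\<dots> = (\<Sum>y\<in>{y \<in> S. g y = s}. if x = y then 1 else 0)"
      using x(1) by (intro sum.cong) (auto simp: transition_function_zero[OF P])
    also have "\<dots> = (if r = s then 1 else 0)"
      using x finite_S by (simp add: sum.delta')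
    finally show ?thesis .
  qed
  have add: "lumped P (t + u) r s = (\<Sum>v\<in>T. lumped P t r v * lumped P u v s)"
    if tu: "0 \<le> t" "0 \<le> u" and rs: "r \<in> T" "s \<in> T" for t u r s
  proof -
    obtain x where x: "x \<in> S" "g x = r" using rep[OF rs(1)] by blast
    have "lumped P (t + u) r s = (\<Sum>y\<in>{y \<in> S. g y = s}. P (t + u) x y)"
      using x tu rs by (simp add: sum_transition_layer)
    also have "\<dots> = (\<Sum>y\<in>{y \<in> S. g y = s}. \<Sum>z\<in>S. P t x z * P u z y)"
      using x(1) tu by (intro sum.cong) (auto simp: transition_function_add[OF P])
    also have "\<dots> = (\<Sum>z\<in>S. P t x z * (\<Sum>y\<in>{y \<in> S. g y = s}. P u z y))"
      unfolding sum_distrib_left by (rule sum.swap)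
    also have "\<dots> = (\<Sum>z\<in>S. P t x z * lumped P u (g z) s)"
      using tu rs by (intro sum.cong) (auto simp: sum_transition_layer)
    also have "\<dots> = (\<Sum>v\<in>T. (\<Sum>z\<in>{z \<in> S. g z = v}. P t x z) * lumped P u v s)"
      unfolding sum_layers sum_distrib_right by (intro sum.cong) auto
    also have "\<dots> = (\<Sum>v\<in>T. lumped P t r v * lumped P u v s)"
      using x tu by (intro sum.cong) (auto simp: sum_transition_layer)
    finally show ?thesis .
  qed
  have rate: "((\<lambda>h. lumped P h r s / h) \<longlongrightarrow> q' r s) (at_right 0)"
    if rs: "r \<in> T" "s \<in> T" "r \<noteq> s" for r s
  proof -
    obtain x where x: "x \<in> S" "g x = r" using rep[OF rs(1)] by blast
    have lim: "((\<lambda>h. \<Sum>y\<in>{y \<in> S. g y = s}. P h x y / h) \<longlongrightarrow> (\<Sum>y\<in>{y \<in> S. g y = s}. q x y)) (at_right 0)"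
      using x rs by (intro tendsto_sum transition_function_rate[OF P]) auto
    have eq: "(\<Sum>y\<in>{y \<in> S. g y = s}. q x y) = q' r s"
      using x rs by (subst lump) auto
    have "\<forall>\<^sub>F h in at_right 0. (\<Sum>y\<in>{y \<in> S. g y = s}. P h x y / h) = lumped P h r s / h"
      using eventually_at_right_less
      by (rule eventually_mono) (use x rs in \<open>simp add: sum_transition_layer flip: sum_divide_distrib\<close>)
    from Lim_transform_eventually[OF lim this] show ?thesis
      unfolding eq .
  qed
  show ?thesis
    unfolding transition_function_def using finite_T nonneg total zero add rate by auto
qed

end

text \<open>A path of layers is the disjoint union of the finitely many state paths above it. All of
  them have the same probability of continuing into a given layer, so this common value factors out
  of the sum and is the conditional probability.\<close>

theorem lumped_markov_chain:
  assumes chain: "markov_chain M S q \<rho> X"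
    and w: "set_pmf w \<subseteq> T"
    and \<rho>: "\<And>x. x \<in> S \<Longrightarrow> pmf \<rho> x = pmf w (g x) * pmf (L (g x)) x"
  shows "0 \<le> t \<Longrightarrow> y \<in> S \<Longrightarrow>
      \<P>(\<omega> in M. X t \<omega> = y) = pmf (L (g y)) y * \<P>(\<omega> in M. g (X t \<omega>) = g y)"
    and "markov_chain M T q' w (\<lambda>t \<omega>. g (X t \<omega>))"
proof -
  interpret prob_space M
    using chain by (simp add: markov_chain_def)
  obtain P where P: "transition_function S q P"
    and path: "\<And>n \<tau> x s y. \<lbrakk>0 \<le> \<tau> (0::nat); \<And>i. i < n \<Longrightarrow> \<tau> i < \<tau> (Suc i); \<tau> n \<le> s;
      \<And>i. i \<le> n \<Longrightarrow> x i \<in> S; y \<in> S\<rbrakk> \<Longrightarrow>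
      \<P>(\<omega> in M. X s \<omega> = y \<and> (\<forall>i\<le>n. X (\<tau> i) \<omega> = x i)) =
      \<P>(\<omega> in M. \<forall>i\<le>n. X (\<tau> i) \<omega> = x i) * P (s - \<tau> n) (x n) y"
    by (rule markov_chain_transition_function[OF chain]) blast
  have X_S: "X t \<omega> \<in> S" if "0 \<le> t" "\<omega> \<in> space M" for t \<omega>
    using markov_chain_space[OF chain that] .
  have ev: "{\<omega> \<in> space M. X t \<omega> \<in> A} \<in> events" if "0 \<le> t" for t A
    using markov_chain_events[OF chain that] .
  have init: "\<P>(\<omega> in M. X 0 \<omega> = x) = pmf \<rho> x" if "x \<in> S" for x
    using chain that by (simp add: markov_chain_def)
  have layer_prob: "\<P>(\<omega> in M. g (X t \<omega>) = r) = (\<Sum>x\<in>{x \<in> S. g x = r}. \<P>(\<omega> in M. X t \<omega> = x))"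
    if t: "0 \<le> t" for t r
  proof -
    have "{\<omega> \<in> space M. g (X t \<omega>) = r} = (\<Union>x\<in>{x \<in> S. g x = r}. {\<omega> \<in> space M. X t \<omega> = x})"
      using X_S[OF t] by auto
    also have "prob \<dots> = (\<Sum>x\<in>{x \<in> S. g x = r}. \<P>(\<omega> in M. X t \<omega> = x))"
      using finite_S ev[OF t, of "{_}"]
      by (intro finite_measure_finite_Union) (auto simp: disjoint_family_on_def)
    finally show ?thesis .
  qed
  \<comment> \<open>Total probability over the initial state; the path property is applied with the
    single observation time 0.\<close>
  have law: "\<P>(\<omega> in M. X t \<omega> = y) = (\<Sum>x\<in>S. pmf \<rho> x * P t x y)" if t: "0 \<le> t" and y: "y \<in> S" for t y
  proof -
    have "{\<omega> \<in> space M. X t \<omega> = y} = (\<Union>x\<in>S. {\<omega> \<in> space M. X t \<omega> = y \<and> X 0 \<omega> = x})"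
      using X_S[of 0] by auto
    also have "prob \<dots> = (\<Sum>x\<in>S. \<P>(\<omega> in M. X t \<omega> = y \<and> X 0 \<omega> = x))"
      using finite_S sets.Int[OF ev[OF t, of "{y}"] ev[of 0 "{_}"]]
      by (intro finite_measure_finite_Union) (auto simp: disjoint_family_on_def Int_def conj_ac)
    also have "\<dots> = (\<Sum>x\<in>S. pmf \<rho> x * P t x y)"
    proof (rule sum.cong)
      fix x assume x: "x \<in> S"
      show "\<P>(\<omega> in M. X t \<omega> = y \<and> X 0 \<omega> = x) = pmf \<rho> x * P t x y"
        using path[of "\<lambda>_. 0" 0 t "\<lambda>_. x" y] x y t init by simp
    qed simp
    finally show ?thesis .
  qed
  have law': "\<P>(\<omega> in M. X t \<omega> = y) = pmf (L (g y)) y * (\<Sum>r\<in>T. pmf w r * lumped P t r (g y))"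
    if t: "0 \<le> t" and y: "y \<in> S" for t y
  proof -
    have "\<P>(\<omega> in M. X t \<omega> = y) = (\<Sum>x\<in>S. pmf w (g x) * pmf (L (g x)) x * P t x y)"
      unfolding law[OF t y] by (intro sum.cong) (auto simp: \<rho>)
    also have "\<dots> = (\<Sum>r\<in>T. \<Sum>x\<in>{x \<in> S. g x = r}. pmf w r * (pmf (L r) x * P t x y))"
      unfolding sum_layers by (intro sum.cong refl) auto
    also have "\<dots> = (\<Sum>r\<in>T. pmf w r * (\<Sum>x\<in>S. pmf (L r) x * P t x y))"
      by (intro sum.cong refl) (simp add: sum_pmf_L sum_distrib_left)
    also have "\<dots> = (\<Sum>r\<in>T. pmf w r * (lumped P t r (g y) * pmf (L (g y)) y))"
      using sum_link_transition[OF P t _ y] by simp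
    finally show ?thesis by (simp add: sum_distrib_left mult_ac)
  qed
  have layer_law: "\<P>(\<omega> in M. g (X t \<omega>) = s) = (\<Sum>r\<in>T. pmf w r * lumped P t r s)"
    if t: "0 \<le> t" and s: "s \<in> T" for t s
  proof -
    have "\<P>(\<omega> in M. g (X t \<omega>) = s) =
        (\<Sum>y\<in>{y \<in> S. g y = s}. pmf (L s) y * (\<Sum>r\<in>T. pmf w r * lumped P t r s))"
      unfolding layer_prob[OF t] using t by (intro sum.cong) (auto simp: law')
    then show ?thesis
      using sum_pmf_L_1[OF s] by (simp flip: sum_distrib_right)
  qed
  show "\<P>(\<omega> in M. X t \<omega> = y) = pmf (L (g y)) y * \<P>(\<omega> in M. g (X t \<omega>) = g y)"
    if "0 \<le> t" "y \<in> S" for t y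
    using that by (simp add: law' layer_law g_T)
  show "markov_chain M T q' w (\<lambda>t \<omega>. g (X t \<omega>))"
    unfolding markov_chain_def
  proof (intro conjI allI ballI impI exI[of _ "lumped P"])
    show "prob_space M" by (rule prob_space_axioms)
    show "(\<lambda>\<omega>. g (X t \<omega>)) \<in> M \<rightarrow>\<^sub>M count_space T" if "0 \<le> t" for t
    proof -
      have "X t \<in> M \<rightarrow>\<^sub>M count_space S" using chain that by (simp add: markov_chain_def)
      moreover have "g \<in> count_space S \<rightarrow>\<^sub>M count_space T" using g_T by auto
      ultimately show ?thesis by (rule measurable_compose)
    qed
    show "set_pmf w \<subseteq> T" by (rule w)
    show "\<P>(\<omega> in M. g (X 0 \<omega>) = r) = pmf w r" if r: "r \<in> T" for r
    proof -
      have "\<P>(\<omega> in M. g (X 0 \<omega>) = r) = (\<Sum>x\<in>{x \<in> S. g x = r}. pmf w r * pmf (L r) x)"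
        unfolding layer_prob[OF order.refl] by (intro sum.cong) (auto simp: init \<rho>)
      then show ?thesis using sum_pmf_L_1[OF r] by (simp flip: sum_distrib_left)
    qed
    show "transition_function T q' (lumped P)"
      by (rule transition_function_lumped[OF P])
  next
    fix n :: nat and \<tau> :: "nat \<Rightarrow> real" and r s y
    assume y: "y \<in> T" and A: "0 \<le> \<tau> 0 \<and> (\<forall>i<n. \<tau> i < \<tau> (Suc i)) \<and> \<tau> n \<le> s \<and> (\<forall>i\<le>n. r i \<in> T) \<and>
        0 < \<P>(\<omega> in M. \<forall>i\<le>n. g (X (\<tau> i) \<omega>) = r i)"
    have \<tau>: "0 \<le> \<tau> i" if "i \<le> n" for i
      using nonneg_if_increasing[of \<tau> n i] A that by blast
    have s: "0 \<le> s" using \<tau>[of n] A by simp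
    \<comment> \<open>Extensionality makes the set finite and lets a path be recovered from its
      values up to n, so distinct paths have disjoint events \<open>E x\<close>.\<close>
    define paths where "paths = PiE {..n} (\<lambda>i. {z \<in> S. g z = r i})"
    have fin_paths: "finite paths"
      unfolding paths_def using finite_S by (intro finite_PiE) auto
    define E where "E x = {\<omega> \<in> space M. \<forall>i\<le>n. X (\<tau> i) \<omega> = x i}" for x
    have E_event: "E x \<in> events" for x
      using markov_chain_path_events[OF chain, of n \<tau> "\<lambda>i. {x i}", OF \<tau>] by (simp add: E_def)
    have decomp: "\<omega> \<in> space M \<Longrightarrow> (\<forall>i\<le>n. g (X (\<tau> i) \<omega>) = r i) \<longleftrightarrow> (\<exists>x\<in>paths. \<omega> \<in> E x)" for \<omega>
    proof (intro iffI)
      assume \<omega>: "\<omega> \<in> space M" and "\<forall>i\<le>n. g (X (\<tau> i) \<omega>) = r i"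
      then have "restrict (\<lambda>i. X (\<tau> i) \<omega>) {..n} \<in> paths" "\<omega> \<in> E (restrict (\<lambda>i. X (\<tau> i) \<omega>) {..n})"
        using X_S \<tau> by (auto simp: paths_def E_def)
      then show "\<exists>x\<in>paths. \<omega> \<in> E x" by blast
    next
      assume "\<omega> \<in> space M" "\<exists>x\<in>paths. \<omega> \<in> E x"
      then show "\<forall>i\<le>n. g (X (\<tau> i) \<omega>) = r i" by (auto simp: paths_def E_def PiE_iff)
    qed
    have E_disj: "x = x'" if "x \<in> paths" "x' \<in> paths" "\<omega> \<in> E x" "\<omega> \<in> E x'" for x x' \<omega>
    proof (rule PiE_ext[of _ "{..n}"])
      show "x \<in> PiE {..n} (\<lambda>i. {z \<in> S. g z = r i})" "x' \<in> PiE {..n} (\<lambda>i. {z \<in> S. g z = r i})"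
        using that by (simp_all add: paths_def)
      show "x i = x' i" if "i \<in> {..n}" for i
        using \<open>\<omega> \<in> E x\<close> \<open>\<omega> \<in> E x'\<close> that by (auto simp: E_def)
    qed
    have "{\<omega> \<in> space M. \<forall>i\<le>n. g (X (\<tau> i) \<omega>) = r i} = (\<Union>x\<in>paths. E x)"
      using decomp by (auto simp: E_def)
    then have past: "\<P>(\<omega> in M. \<forall>i\<le>n. g (X (\<tau> i) \<omega>) = r i) = (\<Sum>x\<in>paths. prob (E x))"
      using fin_paths E_event E_disj
      by (simp, intro finite_measure_finite_Union) (auto simp: disjoint_family_on_def)
    define F where "F = (\<lambda>(x, z). {\<omega> \<in> space M. X s \<omega> = z \<and> (\<forall>i\<le>n. X (\<tau> i) \<omega> = x i)})"
    have F_event: "F p \<in> events" for p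
    proof -
      have "F p = {\<omega> \<in> space M. X s \<omega> \<in> {snd p}} \<inter> E (fst p)"
        by (auto simp: F_def E_def split_beta)
      then show ?thesis using sets.Int[OF ev[OF s, of "{snd p}"] E_event[of "fst p"]] by simp
    qed
    have "{\<omega> \<in> space M. g (X s \<omega>) = y \<and> (\<forall>i\<le>n. g (X (\<tau> i) \<omega>) = r i)}
        = (\<Union>p\<in>paths \<times> {z \<in> S. g z = y}. F p)"
      using decomp X_S[OF s] by (auto simp: F_def E_def)
    moreover have "disjoint_family_on F (paths \<times> {z \<in> S. g z = y})"
      using E_disj by (auto simp: disjoint_family_on_def F_def E_def)
    ultimately have "\<P>(\<omega> in M. g (X s \<omega>) = y \<and> (\<forall>i\<le>n. g (X (\<tau> i) \<omega>) = r i))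
        = (\<Sum>p\<in>paths \<times> {z \<in> S. g z = y}. prob (F p))"
      using fin_paths F_event finite_S by (simp, intro finite_measure_finite_Union) auto
    also have "\<dots> = (\<Sum>x\<in>paths. \<Sum>z\<in>{z \<in> S. g z = y}. prob (F (x, z)))"
      by (simp add: sum.cartesian_product)
    also have "\<dots> = (\<Sum>x\<in>paths. prob (E x) * lumped P (s - \<tau> n) (r n) y)"
    proof (rule sum.cong)
      fix x assume x: "x \<in> paths"
      then have xS: "x i \<in> S" "g (x i) = r i" if "i \<le> n" for i
        using that by (auto simp: paths_def PiE_iff)
      have "(\<Sum>z\<in>{z \<in> S. g z = y}. prob (F (x, z))) =
          (\<Sum>z\<in>{z \<in> S. g z = y}. prob (E x) * P (s - \<tau> n) (x n) z)"
        unfolding F_def E_def using A xS by (intro sum.cong) (auto simp: path)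
      also have "\<dots> = prob (E x) * lumped P (s - \<tau> n) (r n) y"
        using A xS[of n] y by (simp add: sum_transition_layer[OF P] flip: sum_distrib_left)
      finally show "(\<Sum>z\<in>{z \<in> S. g z = y}. prob (F (x, z))) = prob (E x) * lumped P (s - \<tau> n) (r n) y" .
    qed simp
    finally show "\<P>(\<omega> in M. g (X s \<omega>) = y \<bar> \<forall>i\<le>n. g (X (\<tau> i) \<omega>) = r i) = lumped P (s - \<tau> n) (r n) y"
      using A by (simp add: cond_prob_def past flip: sum_distrib_right)
  qed
qed

end

section \<open>Convolution of the Gibbs weights\<close>

text \<open>Gould polynomials, formally x / (x + n z) * binomial((x + n z) / w, n) * w^n. The factor
  s = 0 of the falling product is cancelled, so no division by x + n z or w remains; w = 0 gives the
  Abel polynomials x (x + n z)^(n - 1) / n!. The type \<open>real poly\<close> allows an argument by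
  counting roots.\<close>

definition gould_poly :: "real \<Rightarrow> real \<Rightarrow> nat \<Rightarrow> real poly" where
  "gould_poly z w n = (if n = 0 then 1 else
     smult (1 / fact n) (monom 1 1 * (\<Prod>s=1..<n. [:real n * z - real s * w, 1:])))"

lemma poly_gould_poly:
  "poly (gould_poly z w n) x =
     (if n = 0 then 1 else x / fact n * (\<Prod>s=1..<n. x + real n * z - real s * w))"
  by (simp add: gould_poly_def poly_prod poly_monom algebra_simps)

text \<open>Under the difference of step w these polynomials behave like powers under the
  derivative, up to a shift by z. With X = x + (n + 1) z, the products at x + w and at x share the
  factors X - s w for 0 < s < n; the former has X in addition, the latter X - n w.\<close>

lemma gould_poly_diff:
  "poly (gould_poly z w (Suc n)) (x + w) - poly (gould_poly z w (Suc n)) x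
     = w * poly (gould_poly z w n) (x + z)"
proof (cases n)
  case 0
  then show ?thesis by (simp add: poly_gould_poly)
next
  case (Suc m)
  define X where "X = x + real (Suc n) * z"
  define Q where "Q = (\<Prod>s=1..<n. X - real s * w)"
  have "(\<Prod>s=1..<Suc n. x + w + real (Suc n) * z - real s * w) = (\<Prod>s=0..<n. X - real s * w)"
    unfolding X_def One_nat_def prod.shift_bounds_Suc_ivl
    by (intro prod.cong) (auto simp: algebra_simps)
  also have "\<dots> = X * Q"
    using Suc by (simp add: Q_def prod.atLeast_Suc_lessThan)
  finally have 1: "(\<Prod>s=1..<Suc n. x + w + real (Suc n) * z - real s * w) = X * Q" .
  have 2: "(\<Prod>s=1..<Suc n. x + real (Suc n) * z - real s * w) = Q * (X - real n * w)"
    using Suc by (simp add: Q_def X_def)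
  have 3: "(\<Prod>s=1..<n. x + z + real n * z - real s * w) = Q"
    unfolding Q_def X_def by (intro prod.cong) (auto simp: algebra_simps)
  have "(x + w) * (X * Q) - x * (Q * (X - real n * w)) = real (Suc n) * (w * (x + z) * Q)"
    unfolding X_def by (simp add: algebra_simps)
  then have "((x + w) * (X * Q) - x * (Q * (X - real n * w))) / fact (Suc n) = w * (x + z) * Q / fact n"
    by (simp add: fact_Suc del: of_nat_Suc)
  moreover have "poly (gould_poly z w (Suc n)) (x + w) = (x + w) / fact (Suc n) * (X * Q)"
    using poly_gould_poly[of z w "Suc n" "x + w"] unfolding 1 by simp
  moreover have "poly (gould_poly z w (Suc n)) x = x / fact (Suc n) * (Q * (X - real n * w))"
    using poly_gould_poly[of z w "Suc n" x] unfolding 2 by simp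
  moreover have "poly (gould_poly z w n) (x + z) = (x + z) / fact n * Q"
    using poly_gould_poly[of z w n "x + z"] Suc unfolding 3 by simp
  ultimately show ?thesis by (simp add: diff_divide_distrib del: fact_Suc)
qed

text \<open>
  Rothe--Hagen convolution: as a polynomial in \<open>x\<close> the difference of the two sides is
  \<open>w\<close>-periodic by induction and vanishes at \<open>0\<close>.
\<close>

lemma gould_poly_convolution:
  assumes w: "w \<noteq> 0"
  shows "(\<Sum>k\<le>n. poly (gould_poly z w k) x * poly (gould_poly z w (n - k)) y)
    = poly (gould_poly z w n) (x + y)"
proof (induction n arbitrary: x y)
  case 0
  then show ?case by (simp add: poly_gould_poly)
next
  case (Suc n)
  \<comment> \<open>Here y is frozen and only x is the polynomial variable; composing with
    \<open>[:y, 1:]\<close> produces the argument x + y.\<close>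
  define F where "F = (\<Sum>k\<le>Suc n. gould_poly z w k * [:poly (gould_poly z w (Suc n - k)) y:])
    - pcompose (gould_poly z w (Suc n)) [:y, 1:]"
  have F: "poly F x = (\<Sum>k\<le>Suc n. poly (gould_poly z w k) x * poly (gould_poly z w (Suc n - k)) y)
    - poly (gould_poly z w (Suc n)) (x + y)" for x
    by (simp add: F_def poly_sum poly_pcompose add.commute[of y] mult.commute[of _ "poly (gould_poly z w _) y"] del: sum.atMost_Suc)
  have gp0: "poly (gould_poly z w 0) x = 1" for x by (simp add: poly_gould_poly)
  have "poly F (x + w) - poly F x = 0" for x
  proof -
    have "poly F (x + w) - poly F x =
      (\<Sum>k\<le>n. (poly (gould_poly z w (Suc k)) (x + w) - poly (gould_poly z w (Suc k)) x)
         * poly (gould_poly z w (n - k)) y)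
      - (poly (gould_poly z w (Suc n)) ((x + y) + w) - poly (gould_poly z w (Suc n)) (x + y))"
      unfolding F sum.atMost_Suc_shift
      by (simp add: gp0 sum_subtractf left_diff_distrib algebra_simps)
    \<comment> \<open>Taking the difference lowers the degree and shifts x by z, so the induction
      hypothesis is applied at x + z.\<close>
    also have "\<dots> = w * ((\<Sum>k\<le>n. poly (gould_poly z w k) (x + z) * poly (gould_poly z w (n - k)) y)
       - poly (gould_poly z w n) ((x + z) + y))"
      unfolding gould_poly_diff by (simp add: sum_distrib_left algebra_simps)
    finally show ?thesis by (simp add: Suc.IH)
  qed
  then have period: "poly F (x + w) = poly F x" for x by simp
  have "poly F 0 = 0"
    unfolding F sum.atMost_Suc_shift by (simp add: poly_gould_poly)
  then have root: "poly F (real m * w) = 0" for m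
  proof (induction m)
    case (Suc m)
    then show ?case using period[of "real m * w"] by (simp add: algebra_simps)
  qed simp
  \<comment> \<open>Since w is nonzero, its multiples form an infinite set of roots.\<close>
  have "F = 0"
  proof (rule ccontr)
    assume "F \<noteq> 0"
    then have "finite {x. poly F x = 0}" by (rule poly_roots_finite)
    moreover have "range (\<lambda>m::nat. real m * w) \<subseteq> {x. poly F x = 0}" using root by auto
    moreover have "inj (\<lambda>m::nat. real m * w)" using w by (auto intro: injI)
    ultimately show False using finite_subset range_inj_infinite by blast
  qed
  then show ?case using F[of x] by simp
qed

text \<open>Put k = m + 1, x = a + b / 2 and s = k - r: the factor k a + b r / 2 becomes k x - s b /
  2. The factor s = 0 is k x, whose k cancels one factor of k!, so the argument and the shift are
  both x.\<close>

lemma gibbs_weight_gould_poly: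
  "gibbs_weight a b (Suc m) = poly (gould_poly (a + b / 2) (b / 2) m) (a + b / 2)"
proof (cases m)
  case 0
  then show ?thesis by (simp add: gibbs_weight_def poly_gould_poly)
next
  case (Suc n)
  define x where "x = a + b / 2"
  have "(\<Prod>r=2..Suc m. real (Suc m) * a + b * real r / 2) = (\<Prod>r=1..<Suc m. real (Suc m) * a + b * real (Suc r) / 2)"
    by (rule prod.reindex_bij_witness[of _ Suc "\<lambda>r. r - 1"]) auto
  also have "\<dots> = (\<Prod>r=1..<Suc m. real (Suc m) * x - real (m - r) * (b / 2))"
    by (intro prod.cong refl) (auto simp: x_def of_nat_diff field_simps)
  also have "\<dots> = (\<Prod>s=0..<m. real (Suc m) * x - real s * (b / 2))"
    by (rule prod.reindex_bij_witness[of _ "\<lambda>s. m - s" "\<lambda>r. m - r"]) auto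
  also have "\<dots> = real (Suc m) * x * (\<Prod>s=1..<m. real (Suc m) * x - real s * (b / 2))"
    using Suc by (simp add: prod.atLeast_Suc_lessThan)
  finally have "gibbs_weight a b (Suc m) =
    1 / fact (Suc m) * (real (Suc m) * x * (\<Prod>s=1..<m. real (Suc m) * x - real s * (b / 2)))"
    by (simp add: gibbs_weight_def)
  also have "\<dots> = x / fact m * (\<Prod>s=1..<m. x + real m * x - real s * (b / 2))"
    by (simp add: fact_Suc field_simps del: of_nat_Suc) (simp add: algebra_simps)
  finally show ?thesis
    using Suc by (simp add: poly_gould_poly x_def)
qed

text \<open>The convolution is the Gould polynomial of index m at 2 x, the next weight the one of
  index m + 1 at x. Their products differ only by the last factor (m + 2) x - m b / 2, which is (m +
  2) a + b.\<close>

lemma gibbs_weight_convolution_nonzero: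
  assumes "b \<noteq> 0"
  shows "(\<Sum>i\<le>m. gibbs_weight a b (Suc i) * gibbs_weight a b (Suc (m - i))) * ((real m + 2) * a + b) / 2
    = (real m + 1) * gibbs_weight a b (Suc (Suc m))"
proof -
  define x where "x = a + b / 2"
  have eq: "(real m + 2) * a + b = (2 + real m) * x - real m * (b / 2)"
    by (simp add: x_def algebra_simps)
  have "(\<Sum>i\<le>m. gibbs_weight a b (Suc i) * gibbs_weight a b (Suc (m - i)))
    = poly (gould_poly x (b / 2) m) (x + x)"
    using assms by (simp add: gibbs_weight_gould_poly gould_poly_convolution x_def)
  moreover have "gibbs_weight a b (Suc (Suc m)) = poly (gould_poly x (b / 2) (Suc m)) x"
    by (simp add: gibbs_weight_gould_poly x_def)
  moreover have "poly (gould_poly x (b / 2) m) (x + x) * ((real m + 2) * a + b) / 2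
    = (real m + 1) * poly (gould_poly x (b / 2) (Suc m)) x"
  \<comment> \<open>At m = 0 the Gould polynomial is the constant 1 and not given by its product
    formula.\<close>
  proof (cases "m = 0")
    case True
    then show ?thesis by (simp add: poly_gould_poly x_def)
  next
    case False
    define Q where "Q = (\<Prod>s=1..<m. x + x + real m * x - real s * (b / 2))"
    define K where "K = (real m + 2) * a + b"
    have "(\<Prod>s=1..<Suc m. x + real (Suc m) * x - real s * (b / 2)) = Q * K"
      unfolding K_def eq Q_def using False by (simp add: algebra_simps)
    then have 1: "poly (gould_poly x (b / 2) (Suc m)) x = x / fact (Suc m) * (Q * K)"
      using poly_gould_poly[of x "b / 2" "Suc m" x] by simp
    have 2: "poly (gould_poly x (b / 2) m) (x + x) = (x + x) / fact m * Q"
      using poly_gould_poly[of x "b / 2" m "x + x"] False by (simp add: Q_def)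
    have "fact (Suc m) = (real m + 1) * fact m"
      by (simp add: algebra_simps)
    then have 3: "x / fact (Suc m) = x / fact m / (real m + 1)"
      by (simp add: field_simps del: fact_Suc)
    show ?thesis
      unfolding K_def[symmetric] 1 2 3 by simp
  qed
  ultimately show ?thesis by simp
qed

text \<open>Both sides are polynomial in b, so the case b = 0 follows from the others by continuity.
  The factor k - 1 will be the total splitting rate of a group of size k.\<close>

lemma gibbs_weight_convolution:
  "(\<Sum>i=1..<k. gibbs_weight a b i * gibbs_weight a b (k - i)) * (real k * a + b) / 2
    = (real k - 1) * gibbs_weight a b k" if "1 \<le> k"
proof (cases "k = 1")
  case True
  then show ?thesis by simp
next
  case False
  define m where "m = k - 2"
  have k: "k = Suc (Suc m)" using False \<open>1 \<le> k\<close> by (simp add: m_def)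
  define D where "D b = (\<Sum>i\<le>m. gibbs_weight a b (Suc i) * gibbs_weight a b (Suc (m - i))) * ((real m + 2) * a + b) / 2
    - (real m + 1) * gibbs_weight a b (Suc (Suc m))" for b
  have D_nonzero: "D b = 0" if "b \<noteq> 0" for b
    unfolding D_def gibbs_weight_convolution_nonzero[OF that] by simp
  have "isCont D 0"
    unfolding D_def[abs_def] gibbs_weight_def by (intro continuous_intros) auto
  then have "(D \<longlongrightarrow> D 0) (at 0)" by (simp add: isCont_def)
  moreover have "(D \<longlongrightarrow> 0) (at 0)"
    by (rule Lim_transform_eventually[of "\<lambda>_. 0"])
      (auto simp: D_nonzero eventually_at_filter)
  ultimately have "D 0 = 0" by (rule LIM_unique)
  then have "D b = 0"
    by (cases "b = 0") (simp_all add: D_nonzero)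
  moreover have "(\<Sum>i=1..<k. gibbs_weight a b i * gibbs_weight a b (k - i))
    = (\<Sum>i\<le>m. gibbs_weight a b (Suc i) * gibbs_weight a b (Suc (m - i)))"
    by (rule sum.reindex_bij_witness[of _ Suc "\<lambda>i. i - 1"]) (auto simp: k Suc_diff_le)
  ultimately show ?thesis by (simp add: D_def k algebra_simps)
qed

section \<open>Total transition rates\<close>

definition pairs :: "nat \<Rightarrow> (nat \<times> nat) set" where
  "pairs N = {(i, j). 1 \<le> i \<and> i \<le> j \<and> i + j \<le> N}"

definition pair_coag_rate :: "(nat \<Rightarrow> nat \<Rightarrow> real) \<Rightarrow> (nat \<Rightarrow> nat) \<Rightarrow> nat \<Rightarrow> nat \<Rightarrow> real" where
  "pair_coag_rate \<psi> \<eta> i j =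
     (if i = j then real (\<eta> i) * (real (\<eta> i) - 1) / 2 * \<psi> i i else real (\<eta> i) * real (\<eta> j) * \<psi> i j)"

lemma finite_pairs [simp]: "finite (pairs N)"
  by (rule finite_subset[of _ "{..N} \<times> {..N}"]) (auto simp: pairs_def)

lemma finite_Omega [simp]: "finite (Omega N)"
proof (rule finite_subset)
  have "\<eta> i \<in> {..N}" if "\<eta> \<in> Omega N" "i \<in> {1..N}" for \<eta> i
  proof -
    have "i * \<eta> i \<le> (\<Sum>i=1..N. i * \<eta> i)" using that by (intro member_le_sum) auto
    then have "i * \<eta> i \<le> N" using that(1) by (simp add: Omega_def)
    moreover have "1 * \<eta> i \<le> i * \<eta> i" using that(2) by (intro mult_le_mono1) simp
    ultimately show ?thesis unfolding atMost_iff by linarith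
  qed
  moreover have "\<eta> i = 0" if "\<eta> \<in> Omega N" "i \<notin> {1..N}" for \<eta> i
    using that by (simp add: Omega_def)
  ultimately show "Omega N \<subseteq> {\<eta>. \<forall>i. (i \<in> {1..N} \<longrightarrow> \<eta> i \<in> {..N}) \<and> (i \<notin> {1..N} \<longrightarrow> \<eta> i = 0)}"
    by blast
  show "finite {\<eta>. \<forall>i. (i \<in> {1..N} \<longrightarrow> \<eta> i \<in> {..N}) \<and> (i \<notin> {1..N} \<longrightarrow> \<eta> i = (0::nat))}"
    by (rule finite_set_of_finite_funs) auto
qed

lemma finite_Omega_groups [simp]: "finite (Omega_groups N r)"
  by (rule finite_subset[OF _ finite_Omega[of N]]) (auto simp: Omega_groups_def)

section \<open>Coagulation and fragmentation as inverse moves between layers\<close>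

lemma frag_coag: "can_coag i j \<zeta> \<Longrightarrow> frag i j (coag i j \<zeta>) = \<zeta>"
  by (auto simp: fun_eq_iff frag_def coag_def can_coag_def split: if_splits)

lemma coag_frag: "can_frag i j \<eta> \<Longrightarrow> coag i j (frag i j \<eta>) = \<eta>"
  by (auto simp: fun_eq_iff frag_def coag_def can_frag_def split: if_splits)

lemma can_frag_coag: "can_coag i j \<zeta> \<Longrightarrow> can_frag i j (coag i j \<zeta>)"
  by (auto simp: coag_def can_frag_def can_coag_def)

lemma can_coag_frag: "can_frag i j \<eta> \<Longrightarrow> can_coag i j (frag i j \<eta>)"
  by (auto simp: frag_def can_frag_def can_coag_def)

text \<open>Lets the coagulation rate and the reversed fragmentation rate range over the same pairs,
  so that detailed balance is checked term by term.\<close>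

lemma coag_iff_frag:
  "can_coag i j \<zeta> \<and> \<eta> = coag i j \<zeta> \<longleftrightarrow> can_frag i j \<eta> \<and> \<zeta> = frag i j \<eta>"
  using frag_coag coag_frag can_frag_coag can_coag_frag by metis

text \<open>The subtractions in \<open>coag\<close> are truncated; with them moved to the other side
  the identity can be summed.\<close>

lemma coag_pointwise:
  "can_coag i j \<zeta> \<Longrightarrow>
    coag i j \<zeta> k + of_bool (k = i) + of_bool (k = j) = \<zeta> k + of_bool (k = i + j)"
  by (auto simp: coag_def can_coag_def split: if_splits)

text \<open>Taken with f k = k it is conservation of mass, with f = 1 the loss of one group.\<close>

lemma coag_sum:
  fixes f :: "nat \<Rightarrow> nat"
  assumes "can_coag i j \<zeta>" and "i + j \<le> N"
  shows "(\<Sum>k=1..N. f k * coag i j \<zeta> k) + f i + f j = (\<Sum>k=1..N. f k * \<zeta> k) + f (i + j)"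
proof -
  have ij: "1 \<le> i" "1 \<le> j" using assms(1) by (auto simp: can_coag_def)
  have delta: "(\<Sum>k=1..N. f k * of_bool (k = m)) = f m" if "m \<in> {1..N}" for m
    using that by (simp add: of_bool_def if_distrib sum.delta cong: if_cong)
  have "(\<Sum>k=1..N. f k * (coag i j \<zeta> k + of_bool (k = i) + of_bool (k = j)))
      = (\<Sum>k=1..N. f k * (\<zeta> k + of_bool (k = i + j)))"
    by (simp only: coag_pointwise[OF assms(1)])
  then show ?thesis
    using ij assms(2) delta[of i] delta[of j] delta[of "i + j"]
    unfolding distrib_left sum.distrib by simp
qed

lemma can_frag_le: "\<eta> \<in> Omega N \<Longrightarrow> can_frag i j \<eta> \<Longrightarrow> i + j \<le> N"
  by (auto simp: Omega_def can_frag_def)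

text \<open>Two coexisting groups cannot weigh more than the whole state: for i = j both copies are
  counted through the multiplicity, otherwise the two sizes contribute separate terms to the
  mass.\<close>

lemma can_coag_le:
  assumes "\<zeta> \<in> Omega N" and c: "can_coag i j \<zeta>"
  shows "i + j \<le> N"
proof -
  have ij: "i \<in> {1..N}" "j \<in> {1..N}"
    using assms by (auto simp: Omega_def can_coag_def split: if_splits)
  have "(\<Sum>k\<in>{i, j}. k * \<zeta> k) \<le> (\<Sum>k=1..N. k * \<zeta> k)"
    using ij by (intro sum_mono2) auto
  then have sum: "(\<Sum>k\<in>{i, j}. k * \<zeta> k) \<le> N"
    using assms(1) by (simp add: Omega_def)
  show ?thesis
  proof (cases "i = j")
    case True
    then have "i * 2 \<le> i * \<zeta> i" using c by (intro mult_le_mono2) (simp add: can_coag_def)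
    moreover have "i * \<zeta> i \<le> N" using sum True by simp
    ultimately show ?thesis using True by linarith
  next
    case False
    then have "i * 1 \<le> i * \<zeta> i" "j * 1 \<le> j * \<zeta> j"
      using c by (auto simp: can_coag_def simp del: mult_1_right intro!: mult_le_mono2)
    moreover have "i * \<zeta> i + j * \<zeta> j \<le> N" using sum False by simp
    ultimately show ?thesis by linarith
  qed
qed

lemma coag_Omega_iff:
  assumes c: "can_coag i j \<zeta>" and le: "i + j \<le> N"
  shows "coag i j \<zeta> \<in> Omega N \<longleftrightarrow> \<zeta> \<in> Omega N"
proof -
  have "(\<forall>k. k \<notin> {1..N} \<longrightarrow> coag i j \<zeta> k = 0) \<longleftrightarrow> (\<forall>k. k \<notin> {1..N} \<longrightarrow> \<zeta> k = 0)"
  proof -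
    have "coag i j \<zeta> k = \<zeta> k" if "k \<notin> {1..N}" for k
      using that c le by (auto simp: coag_def can_coag_def)
    then show ?thesis by simp
  qed
  then show ?thesis
    using coag_sum[OF c le, of "\<lambda>k. k"] unfolding Omega_def by simp
qed

lemma groups_coag: "can_coag i j \<zeta> \<Longrightarrow> i + j \<le> N \<Longrightarrow> groups N \<zeta> = groups N (coag i j \<zeta>) + 1"
  using coag_sum[of i j \<zeta> N "\<lambda>_. 1"] by (simp add: groups_def)

lemma coag_in_layer:
  assumes "\<zeta> \<in> Omega_groups N (Suc r)" and c: "can_coag i j \<zeta>"
  shows "coag i j \<zeta> \<in> Omega_groups N r"
  using assms can_coag_le[of \<zeta> N i j] coag_Omega_iff[OF c, of N] groups_coag[OF c, of N]
  by (simp add: Omega_groups_def)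

lemma frag_in_layer:
  assumes "\<eta> \<in> Omega_groups N r" and c: "can_frag i j \<eta>"
  shows "frag i j \<eta> \<in> Omega_groups N (Suc r)"
  using assms can_frag_le[of \<eta> N i j] coag_Omega_iff[OF can_coag_frag[OF c], of N]
    groups_coag[OF can_coag_frag[OF c], of N] coag_frag[OF c]
  by (simp add: Omega_groups_def)

section \<open>Rates as sums over a fixed set of pairs, and their row sums\<close>

lemma coag_rate_eq:
  "coag_rate N \<psi> \<zeta> \<eta> =
    (\<Sum>(i, j)\<in>pairs N. if can_coag i j \<zeta> \<and> \<eta> = coag i j \<zeta> then pair_coag_rate \<psi> \<zeta> i j else 0)"
  unfolding coag_rate_def
  by (rule sum.mono_neutral_cong_left) (auto simp: pairs_def[symmetric] pair_coag_rate_def, auto simp: pairs_def split: if_splits)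

lemma frag_rate_eq:
  "frag_rate N \<phi> \<eta> \<zeta> =
    (\<Sum>(i, j)\<in>pairs N. if can_frag i j \<eta> \<and> \<zeta> = frag i j \<eta> then real (\<eta> (i + j)) * \<phi> i j else 0)"
  unfolding frag_rate_def
  by (rule sum.mono_neutral_cong_left) (auto simp: pairs_def[symmetric], auto simp: pairs_def split: if_splits)

lemma coag_rate_nonzeroD:
  assumes "coag_rate N \<psi> \<zeta> \<eta> \<noteq> 0"
  obtains i j where "(i, j) \<in> pairs N" "can_coag i j \<zeta>" "\<eta> = coag i j \<zeta>"
proof -
  obtain p where "p \<in> pairs N" "(case p of (i, j) \<Rightarrow>
      if can_coag i j \<zeta> \<and> \<eta> = coag i j \<zeta> then pair_coag_rate \<psi> \<zeta> i j else 0) \<noteq> 0"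
    using assms unfolding coag_rate_eq by (rule sum.not_neutral_contains_not_neutral)
  then show ?thesis using that by (auto split: if_splits prod.splits)
qed

lemma frag_rate_nonzeroD:
  assumes "frag_rate N \<phi> \<eta> \<zeta> \<noteq> 0"
  obtains i j where "(i, j) \<in> pairs N" "can_frag i j \<eta>" "\<zeta> = frag i j \<eta>"
proof -
  obtain p where "p \<in> pairs N" "(case p of (i, j) \<Rightarrow>
      if can_frag i j \<eta> \<and> \<zeta> = frag i j \<eta> then real (\<eta> (i + j)) * \<phi> i j else 0) \<noteq> 0"
    using assms unfolding frag_rate_eq by (rule sum.not_neutral_contains_not_neutral)
  then show ?thesis using that by (auto split: if_splits prod.splits)
qed

lemma coag_rate_groups: "coag_rate N \<psi> \<zeta> \<eta> \<noteq> 0 \<Longrightarrow> groups N \<zeta> = groups N \<eta> + 1"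
  by (elim coag_rate_nonzeroD) (auto simp: groups_coag pairs_def)

lemma frag_rate_groups: "frag_rate N \<phi> \<eta> \<zeta> \<noteq> 0 \<Longrightarrow> groups N \<zeta> = groups N \<eta> + 1"
  by (elim frag_rate_nonzeroD) (use groups_coag can_coag_frag coag_frag in \<open>fastforce simp: pairs_def\<close>)

lemma coag_rate_neighbours: "coag_rate N \<psi> \<zeta> \<eta> \<noteq> 0 \<Longrightarrow> neighbours \<zeta> \<eta>"
  by (elim coag_rate_nonzeroD) (auto simp: neighbours_def single_step_def)

lemma frag_rate_neighbours: "frag_rate N \<phi> \<eta> \<zeta> \<noteq> 0 \<Longrightarrow> neighbours \<eta> \<zeta>"
  by (elim frag_rate_nonzeroD) (auto simp: neighbours_def single_step_def)

text \<open>Each pair has at most one target, so exchanging the sums leaves one term per pair. For a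
  pair that cannot coagulate the rate formula itself vanishes, as n (n - 1) does for n \<le>
  1.\<close>

lemma coag_rate_row:
  assumes "\<zeta> \<in> Omega_groups N (Suc r)"
  shows "(\<Sum>\<eta>\<in>Omega_groups N r. coag_rate N \<psi> \<zeta> \<eta>) = (\<Sum>(i, j)\<in>pairs N. pair_coag_rate \<psi> \<zeta> i j)"
  unfolding coag_rate_eq
proof (subst sum.swap, rule sum.cong, simp, clarify)
  fix i j assume ij: "(i, j) \<in> pairs N"
  show "(\<Sum>\<eta>\<in>Omega_groups N r. if can_coag i j \<zeta> \<and> \<eta> = coag i j \<zeta> then pair_coag_rate \<psi> \<zeta> i j else 0)
      = pair_coag_rate \<psi> \<zeta> i j"
  proof (cases "can_coag i j \<zeta>")
    case True
    then show ?thesis using coag_in_layer[OF assms True] by (simp add: sum.delta)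
  next
    case False
    then have "pair_coag_rate \<psi> \<zeta> i j = 0"
      using ij by (auto simp: pair_coag_rate_def can_coag_def pairs_def not_le less_Suc_eq numeral_2_eq_2 split: if_splits)
    then show ?thesis using False by simp
  qed
qed

lemma frag_rate_row:
  assumes "\<eta> \<in> Omega_groups N r"
  shows "(\<Sum>\<zeta>\<in>Omega_groups N (Suc r). frag_rate N \<phi> \<eta> \<zeta>) = (\<Sum>(i, j)\<in>pairs N. real (\<eta> (i + j)) * \<phi> i j)"
  unfolding frag_rate_eq
proof (subst sum.swap, rule sum.cong, simp, clarify)
  fix i j assume ij: "(i, j) \<in> pairs N"
  show "(\<Sum>\<zeta>\<in>Omega_groups N (Suc r). if can_frag i j \<eta> \<and> \<zeta> = frag i j \<eta> then real (\<eta> (i + j)) * \<phi> i j else 0)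
      = real (\<eta> (i + j)) * \<phi> i j"
  proof (cases "can_frag i j \<eta>")
    case True
    then show ?thesis using frag_in_layer[OF assms True] by (simp add: sum.delta)
  next
    case False
    then have "\<eta> (i + j) = 0"
      using ij by (auto simp: can_frag_def pairs_def)
    then show ?thesis using False by simp
  qed
qed

text \<open>Reflection shows that the upper and the lower triangle, each with half of the diagonal,
  contribute equally.\<close>

lemma sum_unordered_pairs:
  fixes h :: "nat \<Rightarrow> nat \<Rightarrow> real"
  assumes "finite R" and R: "\<And>i j. (i, j) \<in> R \<Longrightarrow> (j, i) \<in> R" and h: "\<And>i j. (i, j) \<in> R \<Longrightarrow> h i j = h j i"
  shows "(\<Sum>(i, j)\<in>{(i, j) \<in> R. i \<le> j}. if i = j then h i j / 2 else h i j) = (\<Sum>(i, j)\<in>R. h i j) / 2"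
proof -
  define g where "g = (\<lambda>(i, j). if i = j then h i j / 2 else h i j)"
  have eq: "{(i, j) \<in> R. i \<le> j} = {p \<in> R. fst p \<le> snd p}" by auto
  have "(\<Sum>p\<in>R. if fst p \<le> snd p then g p else 0) = (\<Sum>p\<in>R. if snd p \<le> fst p then g p else 0)"
    by (rule sum.reindex_bij_witness[of _ prod.swap prod.swap]) (auto simp: g_def R h)
  moreover have "(\<Sum>p\<in>R. if fst p \<le> snd p then g p else 0) + (\<Sum>p\<in>R. if snd p \<le> fst p then g p else 0)
      = (\<Sum>(i, j)\<in>R. h i j)"
    unfolding sum.distrib[symmetric] by (intro sum.cong) (auto simp: g_def)
  ultimately show ?thesis
    unfolding eq g_def[symmetric] using assms(1) by (simp add: sum.inter_filter)
qed

text \<open>Ordered pairs of distinct groups are all ordered pairs minus the self-pairs. With mass N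
  and r groups this gives 2 a N r + b r^2 - (2 a N + b r) = (r - 1) (2 a N + b r), and half of it is
  \<open>mu\<close>.\<close>

lemma total_coag_rate:
  assumes \<psi>: "\<forall>i\<ge>1. \<forall>j\<ge>1. \<psi> i j = a * (real i + real j) + b"
    and \<zeta>: "\<zeta> \<in> Omega_groups N r"
  shows "(\<Sum>(i, j)\<in>pairs N. pair_coag_rate \<psi> \<zeta> i j) = mu a b N r"
proof -
  define h where "h i j = (if i = j then real (\<zeta> i) * (real (\<zeta> i) - 1) else real (\<zeta> i) * real (\<zeta> j)) * (a * (real i + real j) + b)" for i j
  define R where "R = {1..N} \<times> {1..N}"
  have mass: "(\<Sum>i=1..N. real i * real (\<zeta> i)) = real N"
  proof -
    have "(\<Sum>i=1..N. i * \<zeta> i) = N" using \<zeta> by (simp add: Omega_groups_def Omega_def)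
    then have "real (\<Sum>i=1..N. i * \<zeta> i) = real N" by simp
    then show ?thesis by simp
  qed
  have count: "(\<Sum>i=1..N. real (\<zeta> i)) = real r"
    using \<zeta> by (auto simp: Omega_groups_def groups_def)
  have "(\<Sum>(i, j)\<in>pairs N. pair_coag_rate \<psi> \<zeta> i j) =
      (\<Sum>(i, j)\<in>{(i, j) \<in> R. i \<le> j}. if i = j then h i j / 2 else h i j)"
  proof (rule sum.mono_neutral_cong_left)
    show "finite {(i, j) \<in> R. i \<le> j}"
      by (rule finite_subset[of _ R]) (auto simp: R_def)
    show "pairs N \<subseteq> {(i, j) \<in> R. i \<le> j}" by (auto simp: R_def pairs_def)
    \<comment> \<open>Groups with i + j > N do not coexist in a state of mass N, so enlarging the
      index set to the square adds only zeros.\<close>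
    show "\<forall>p\<in>{(i, j) \<in> R. i \<le> j} - pairs N. (case p of (i, j) \<Rightarrow> if i = j then h i j / 2 else h i j) = 0"
    proof clarify
      fix i j assume ij: "(i, j) \<in> R" "i \<le> j" "(i, j) \<notin> pairs N"
      then have "\<not> can_coag i j \<zeta>"
        using can_coag_le[of \<zeta> N i j] \<zeta> by (auto simp: R_def pairs_def Omega_groups_def)
      then show "(if i = j then h i j / 2 else h i j) = 0"
        using ij by (auto simp: h_def R_def can_coag_def not_le less_Suc_eq numeral_2_eq_2 split: if_splits)
    qed
    show "(case p of (i, j) \<Rightarrow> pair_coag_rate \<psi> \<zeta> i j) = (case p of (i, j) \<Rightarrow> if i = j then h i j / 2 else h i j)"
      if "p \<in> pairs N" for p
      using that \<psi> by (auto simp: pairs_def pair_coag_rate_def h_def)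
  qed
  also have "\<dots> = (\<Sum>(i, j)\<in>R. h i j) / 2"
    by (rule sum_unordered_pairs) (auto simp: R_def h_def)
  also have "(\<Sum>(i, j)\<in>R. h i j) = (\<Sum>i=1..N. \<Sum>j=1..N. real (\<zeta> i) * real (\<zeta> j) * (a * (real i + real j) + b)
      - (if i = j then real (\<zeta> i) * (2 * a * real i + b) else 0))"
    unfolding R_def sum.cartesian_product[symmetric]
    by (intro sum.cong refl) (auto simp: h_def algebra_simps)
  also have "\<dots> = (\<Sum>i=1..N. \<Sum>j=1..N. real (\<zeta> i) * real (\<zeta> j) * (a * (real i + real j) + b))
      - (\<Sum>i=1..N. real (\<zeta> i) * (2 * a * real i + b))"
    unfolding sum_subtractf by (simp add: sum.delta)
  also have "(\<Sum>i=1..N. \<Sum>j=1..N. real (\<zeta> i) * real (\<zeta> j) * (a * (real i + real j) + b))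
      = (\<Sum>i=1..N. a * (real i * real (\<zeta> i)) * real r + real (\<zeta> i) * (a * real N) + real (\<zeta> i) * (b * real r))"
  proof (rule sum.cong)
    fix i
    have "(\<Sum>j=1..N. real (\<zeta> i) * real (\<zeta> j) * (a * (real i + real j) + b))
       = (\<Sum>j=1..N. a * (real i * real (\<zeta> i)) * real (\<zeta> j) + real (\<zeta> i) * (a * (real j * real (\<zeta> j))) + real (\<zeta> i) * (b * real (\<zeta> j)))"
      by (intro sum.cong refl) (simp add: algebra_simps)
    also have "\<dots> = a * (real i * real (\<zeta> i)) * real r + real (\<zeta> i) * (a * real N) + real (\<zeta> i) * (b * real r)"
      unfolding sum.distrib sum_distrib_left[symmetric] mass count by (rule refl)
    finally show "(\<Sum>j=1..N. real (\<zeta> i) * real (\<zeta> j) * (a * (real i + real j) + b))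
      = a * (real i * real (\<zeta> i)) * real r + real (\<zeta> i) * (a * real N) + real (\<zeta> i) * (b * real r)" .
  qed simp
  also have "\<dots> = a * real N * real r + real r * (a * real N) + real r * (b * real r)"
    unfolding sum.distrib sum_distrib_right[symmetric] sum_distrib_left[symmetric] mass count by (rule refl)
  also have "(\<Sum>i=1..N. real (\<zeta> i) * (2 * a * real i + b)) = (\<Sum>i=1..N. 2 * a * (real i * real (\<zeta> i)) + real (\<zeta> i) * b)"
    by (intro sum.cong refl) (simp add: algebra_simps)
  also have "\<dots> = 2 * a * real N + real r * b"
    unfolding sum.distrib sum_distrib_right[symmetric] sum_distrib_left[symmetric] mass count by (rule refl)
  finally show ?thesis by (simp add: mu_def field_simps)
qed

text \<open>Pairs are collected by k = i + j: each of the n_k groups of size k splits at total rate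
  c (k - 1), and the sum of n_k (k - 1) is the mass minus the number of groups.\<close>

lemma total_frag_rate:
  assumes \<phi>: "\<And>k. 1 \<le> k \<Longrightarrow> (\<Sum>(i, j)\<in>{(i, j). 1 \<le> i \<and> i \<le> j \<and> i + j = k}. \<phi> i j) = c * (real k - 1)"
    and \<eta>: "\<eta> \<in> Omega_groups N r"
  shows "(\<Sum>(i, j)\<in>pairs N. real (\<eta> (i + j)) * \<phi> i j) = c * (real N - real r)"
proof -
  have "(\<Sum>(i, j)\<in>pairs N. real (\<eta> (i + j)) * \<phi> i j) =
      (\<Sum>k=1..N. \<Sum>p\<in>{p \<in> pairs N. fst p + snd p = k}. real (\<eta> (fst p + snd p)) * \<phi> (fst p) (snd p))"
    by (subst sum.group) (auto simp: case_prod_unfold, auto simp: pairs_def)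
  also have "\<dots> = (\<Sum>k=1..N. real (\<eta> k) * (c * (real k - 1)))"
  proof (rule sum.cong)
    fix k assume k: "k \<in> {1..N}"
    have "{p \<in> pairs N. fst p + snd p = k} = {(i, j). 1 \<le> i \<and> i \<le> j \<and> i + j = k}"
      using k by (auto simp: pairs_def)
    then have "(\<Sum>p\<in>{p \<in> pairs N. fst p + snd p = k}. real (\<eta> (fst p + snd p)) * \<phi> (fst p) (snd p))
        = (\<Sum>(i, j)\<in>{(i, j). 1 \<le> i \<and> i \<le> j \<and> i + j = k}. real (\<eta> k) * \<phi> i j)"
      by (intro sum.cong) auto
    also have "\<dots> = real (\<eta> k) * (c * (real k - 1))"
      using \<phi>[of k] k by (simp add: sum_distrib_left[symmetric] case_prod_unfold)
    finally show "(\<Sum>p\<in>{p \<in> pairs N. fst p + snd p = k}. real (\<eta> (fst p + snd p)) * \<phi> (fst p) (snd p))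
        = real (\<eta> k) * (c * (real k - 1))" .
  qed simp
  also have "\<dots> = c * (real (\<Sum>k=1..N. k * \<eta> k) - real (\<Sum>k=1..N. \<eta> k))"
    by (simp add: sum_distrib_left sum_subtractf[symmetric] algebra_simps)
  also have "\<dots> = c * (real N - real r)"
    using \<eta> by (simp add: Omega_groups_def Omega_def groups_def)
  finally show ?thesis .
qed

section \<open>Gibbs layers\<close>

definition gibbs_measure :: "real \<Rightarrow> real \<Rightarrow> nat \<Rightarrow> (nat \<Rightarrow> nat) \<Rightarrow> real" where
  "gibbs_measure a b N \<eta> = (\<Prod>k=1..N. gibbs_weight a b k ^ \<eta> k / fact (\<eta> k))"

text \<open>Normalised: the value at (1, 1) is 1 whenever 2 a + b is nonzero, so
  \<open>\<phi> 1 1\<close> remains as the only free factor of a fragmentation kernel proportional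
  to it.\<close>

definition gibbs_frag :: "real \<Rightarrow> real \<Rightarrow> nat \<Rightarrow> nat \<Rightarrow> real" where
  "gibbs_frag a b i j =
     (if i = j then (gibbs_weight a b i)\<^sup>2 / (2 * gibbs_weight a b (2 * i)) * (2 * a * real i + b)
      else gibbs_weight a b i * gibbs_weight a b j / gibbs_weight a b (i + j) * (a * (real i + real j) + b))"

lemma gibbs_layers_iff:
  "gibbs_layers a b N \<rho> \<longleftrightarrow>
    (\<forall>r\<in>{1..N}. \<forall>\<eta>\<in>Omega_groups N r. pmf (\<rho> r) \<eta> = gibbs_measure a b N \<eta> / gibbs_norm a b N r)"
  by (simp add: gibbs_layers_def gibbs_measure_def)

text \<open>The worst case depends on the sign of b: for b \<ge> 0 it is m = n = 1, for b < 0 it is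
  m = n, where the value is n (2 a + b).\<close>

lemma affine_pos:
  fixes a b :: real
  assumes "0 \<le> a" and "0 < 2 * a + b" and "1 \<le> m" and "m \<le> n"
  shows "0 < 2 * a * real n + real m * b"
proof (cases "0 \<le> b")
  case True
  have "a * real 1 \<le> a * real n" "b * real 1 \<le> b * real m"
    using assms True by (intro mult_left_mono; simp)+
  then show ?thesis using assms(2) by (simp add: algebra_simps)
next
  case False
  have "0 < (2 * a + b) * real n"
    using assms by (intro mult_pos_pos) auto
  also have "\<dots> \<le> 2 * a * real n + real m * b"
    using False assms(4) by (simp add: algebra_simps mult_right_mono_neg)
  finally show ?thesis .
qed

lemma gibbs_weight_pos:
  assumes "0 \<le> a" and "0 < 2 * a + b"
  shows "0 < gibbs_weight a b k"
  unfolding gibbs_weight_def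
proof (intro mult_pos_pos prod_pos)
  fix r assume "r \<in> {2..k}"
  then show "0 < real k * a + b * real r / 2"
    using affine_pos[OF assms, of r k] by (simp add: field_simps)
qed simp

lemma mu_pos:
  assumes "0 \<le> a" and "0 < 2 * a + b" and "2 \<le> l" and "l \<le> N"
  shows "0 < mu a b N l"
  using assms affine_pos[of a b l N] by (simp add: mu_def)

lemma gibbs_norm_alt:
  "gibbs_norm a b N r = (\<Prod>l=r+1..N. mu a b N l) / (fact N * fact (N - r))"
  by (simp add: gibbs_norm_def mu_def)

lemma gibbs_norm_pos:
  assumes "0 \<le> a" and "0 < 2 * a + b" and "1 \<le> r"
  shows "0 < gibbs_norm a b N r"
  unfolding gibbs_norm_alt
proof (intro divide_pos_pos prod_pos mult_pos_pos)
  fix l assume "l \<in> {r + 1..N}"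
  then show "0 < mu a b N l" using assms by (intro mu_pos) auto
qed auto

text \<open>With \<open>gibbs_norm\<close> read as the mass of a layer under the Gibbs measure, this
  equates the fragmentation flux from layer r with the coagulation flux back from layer r +
  1.\<close>

lemma gibbs_norm_Suc:
  assumes "r < N"
  shows "gibbs_norm a b N r * (real N - real r) = gibbs_norm a b N (Suc r) * mu a b N (Suc r)"
proof -
  define A where "A = (\<Prod>l=Suc r+1..N. mu a b N l)"
  have 1: "(\<Prod>l=r+1..N. mu a b N l) = mu a b N (Suc r) * A"
    unfolding A_def using assms by (simp add: prod.atLeast_Suc_atMost)
  have 2: "fact (N - r) = (real N - real r) * fact (N - Suc r)"
  proof -
    have "N - r = Suc (N - Suc r)" using assms by simp
    then have "fact (N - r) = real (Suc (N - Suc r)) * fact (N - Suc r)" by (metis fact_Suc)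
    also have "real (Suc (N - Suc r)) = real N - real r" using assms by simp
    finally show ?thesis .
  qed
  have 3: "real N - real r \<noteq> 0" using assms by simp
  show ?thesis
    unfolding gibbs_norm_alt 1 2 A_def[symmetric] using 3 by (simp add: field_simps)
qed

section \<open>Detailed balance of the Gibbs measure\<close>

lemma gibbs_measure_upd:
  assumes "k \<in> {1..N}"
  shows "gibbs_measure a b N (\<xi>(k := Suc (\<xi> k))) * real (Suc (\<xi> k)) = gibbs_measure a b N \<xi> * gibbs_weight a b k"
proof -
  define P where "P = (\<Prod>l\<in>{1..N} - {k}. gibbs_weight a b l ^ \<xi> l / fact (\<xi> l))"
  have 1: "gibbs_measure a b N (\<xi>(k := Suc (\<xi> k))) = gibbs_weight a b k ^ Suc (\<xi> k) / fact (Suc (\<xi> k)) * P"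
    unfolding gibbs_measure_def P_def prod.remove[OF finite_atLeastAtMost assms]
    by (intro arg_cong2[of _ _ _ _ "(*)"] prod.cong) auto
  have 2: "gibbs_measure a b N \<xi> = gibbs_weight a b k ^ \<xi> k / fact (\<xi> k) * P"
    unfolding gibbs_measure_def P_def prod.remove[OF finite_atLeastAtMost assms] by (rule refl)
  have 3: "fact (Suc (\<xi> k)) = real (Suc (\<xi> k)) * fact (\<xi> k)"
    by (rule fact_Suc)
  show ?thesis
    unfolding 1 2 3 by (simp add: field_simps del: of_nat_Suc)
qed

lemma gibbs_detailed_balance_pair:
  assumes pos: "\<And>k. 0 < gibbs_weight a b k"
    and \<psi>: "\<forall>i\<ge>1. \<forall>j\<ge>1. \<psi> i j = a * (real i + real j) + b"
    and ij: "(i, j) \<in> pairs N" and can: "can_frag i j \<eta>"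
  shows "gibbs_measure a b N (frag i j \<eta>) * pair_coag_rate \<psi> (frag i j \<eta>) i j
    = gibbs_measure a b N \<eta> * (real (\<eta> (i + j)) * gibbs_frag a b i j)"
proof -
  define W where "W = gibbs_measure a b N"
  define w where "w = gibbs_weight a b"
  define k where "k = i + j"
  \<comment> \<open>\<xi> is the common remainder, \<eta> without the group that splits. Both states
    arise from it by adding groups, either one of size k or one each of sizes i and j, so both sides
    become multiples of \<open>W \<xi>\<close>.\<close>
  define \<xi> where "\<xi> = \<eta>(k := \<eta> k - 1)"
  define \<xi>' where "\<xi>' = \<xi>(i := Suc (\<xi> i))"
  have ijk: "i \<in> {1..N}" "j \<in> {1..N}" "k \<in> {1..N}" "i \<noteq> k" "j \<noteq> k"
    using ij by (auto simp: pairs_def k_def)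
  have wk: "w k \<noteq> 0" using pos[of k] by (simp add: w_def)
  have \<eta>_k: "Suc (\<xi> k) = \<eta> k"
    using can by (simp add: \<xi>_def can_frag_def k_def)
  have \<eta>: "\<xi>(k := \<eta> k) = \<eta>"
    by (simp add: \<xi>_def)
  have \<zeta>: "frag i j \<eta> = \<xi>'(j := Suc (\<xi>' j))"
    using can ijk by (auto simp: \<xi>'_def \<xi>_def frag_def can_frag_def k_def fun_eq_iff)
  have W\<eta>: "W \<eta> * real (\<eta> k) = W \<xi> * w k"
    using gibbs_measure_upd[OF ijk(3), of a b \<xi>] by (simp only: W_def w_def \<eta>_k \<eta>)
  have Wi: "W \<xi>' * real (Suc (\<xi> i)) = W \<xi> * w i"
    unfolding \<xi>'_def W_def w_def by (rule gibbs_measure_upd[OF ijk(1)])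
  have Wj: "W (frag i j \<eta>) * real (Suc (\<xi>' j)) = W \<xi>' * w j"
    unfolding \<zeta> W_def w_def by (rule gibbs_measure_upd[OF ijk(2)])
  have \<psi>': "\<psi> i j = a * (real i + real j) + b"
    using \<psi> ijk by simp
  show ?thesis
  proof (cases "i = j")
    case True
    \<comment> \<open>Adding the same size twice raises the count by two; the denominators \<xi> i +
      1 and \<xi> i + 2 of the two updates cancel the product n (n - 1) in the rate.\<close>
    have z: "frag i j \<eta> i = Suc (Suc (\<xi> i))" and xj: "\<xi>' j = Suc (\<xi> i)"
      unfolding \<zeta> using True by (simp_all add: \<xi>'_def)
    have "W (frag i j \<eta>) * pair_coag_rate \<psi> (frag i j \<eta>) i j
        = (W (frag i j \<eta>) * real (Suc (\<xi>' j))) * real (Suc (\<xi> i)) * \<psi> i j / 2"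
      unfolding pair_coag_rate_def z xj using True by simp
    also have "\<dots> = W \<xi> * (w i)\<^sup>2 * \<psi> i j / 2"
      unfolding Wj using Wi True by (simp add: power2_eq_square mult_ac)
    also have "\<dots> = W \<xi> * w k * gibbs_frag a b i j"
    proof -
      have "2 * i = k" "2 * a * real i + b = \<psi> i j"
        unfolding \<psi>' k_def using True by simp_all
      then have "gibbs_frag a b i j = (w i)\<^sup>2 / (2 * w k) * \<psi> i j"
        using True by (simp add: gibbs_frag_def w_def)
      then show ?thesis using wk by simp
    qed
    finally show ?thesis
      unfolding W_def[symmetric] k_def[symmetric] mult.assoc[symmetric] W\<eta> .
  next
    case False
    have z: "frag i j \<eta> i = Suc (\<xi> i)" "frag i j \<eta> j = Suc (\<xi>' j)"
      unfolding \<zeta> using False by (simp_all add: \<xi>'_def)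
    have "W (frag i j \<eta>) * pair_coag_rate \<psi> (frag i j \<eta>) i j
        = (W (frag i j \<eta>) * real (Suc (\<xi>' j))) * real (Suc (\<xi> i)) * \<psi> i j"
      using False by (simp add: pair_coag_rate_def z)
    also have "\<dots> = (W \<xi>' * real (Suc (\<xi> i))) * w j * \<psi> i j"
      unfolding Wj by simp
    also have "\<dots> = W \<xi> * w k * gibbs_frag a b i j"
    proof -
      have "gibbs_frag a b i j = w i * w j / w k * \<psi> i j"
        using False by (simp add: gibbs_frag_def \<psi>' w_def k_def)
      then show ?thesis unfolding Wi using wk by simp
    qed
    finally show ?thesis
      unfolding W_def[symmetric] k_def[symmetric] mult.assoc[symmetric] W\<eta> .
  qed
qed

lemma gibbs_detailed_balance:
  assumes pos: "\<And>k. 0 < gibbs_weight a b k"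
    and \<psi>: "\<forall>i\<ge>1. \<forall>j\<ge>1. \<psi> i j = a * (real i + real j) + b"
  shows "gibbs_measure a b N \<zeta> * coag_rate N \<psi> \<zeta> \<eta> = gibbs_measure a b N \<eta> * frag_rate N (gibbs_frag a b) \<eta> \<zeta>"
  unfolding coag_rate_eq frag_rate_eq sum_distrib_left coag_iff_frag
  by (rule sum.cong) (auto simp: gibbs_detailed_balance_pair[OF pos \<psi>])

text \<open>The halved diagonal makes the sum over unordered pairs half of the full convolution of
  the weights.\<close>

lemma gibbs_frag_sum:
  assumes pos: "\<And>k. 0 < gibbs_weight a b k" and k: "1 \<le> k"
  shows "(\<Sum>(i, j)\<in>{(i, j). 1 \<le> i \<and> i \<le> j \<and> i + j = k}. gibbs_frag a b i j) = 1 * (real k - 1)"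
proof -
  define R where "R = {(i, j). 1 \<le> i \<and> 1 \<le> j \<and> i + j = k}"
  define h where "h i j = gibbs_weight a b i * gibbs_weight a b j * ((real k * a + b) / gibbs_weight a b k)" for i j
  have "finite R"
    by (rule finite_subset[of _ "{..k} \<times> {..k}"]) (auto simp: R_def)
  have "(\<Sum>(i, j)\<in>{(i, j). 1 \<le> i \<and> i \<le> j \<and> i + j = k}. gibbs_frag a b i j)
      = (\<Sum>(i, j)\<in>{(i, j) \<in> R. i \<le> j}. if i = j then h i j / 2 else h i j)"
  proof (rule sum.cong)
    show "{(i, j). 1 \<le> i \<and> i \<le> j \<and> i + j = k} = {(i, j) \<in> R. i \<le> j}"
      by (auto simp: R_def)
    fix p assume "p \<in> {(i, j) \<in> R. i \<le> j}"
    then obtain i j where p: "p = (i, j)" and k: "i + j = k" by (auto simp: R_def)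
    have "gibbs_frag a b i j = (if i = j then h i j / 2 else h i j)"
    proof (cases "i = j")
      case True
      have eq: "2 * i = k" "2 * a * real i + b = real k * a + b"
        unfolding k[symmetric] using True by simp_all
      show ?thesis
        unfolding gibbs_frag_def h_def if_P[OF True] eq using True by (simp add: power2_eq_square)
    next
      case False
      have eq: "a * (real i + real j) + b = real k * a + b"
        unfolding k[symmetric] by (simp add: mult.commute)
      show ?thesis
        unfolding gibbs_frag_def h_def if_not_P[OF False] eq k by simp
    qed
    then show "(case p of (i, j) \<Rightarrow> gibbs_frag a b i j) = (case p of (i, j) \<Rightarrow> if i = j then h i j / 2 else h i j)"
      by (simp add: p)
  qed
  also have "\<dots> = (\<Sum>(i, j)\<in>R. h i j) / 2"
    using \<open>finite R\<close> by (rule sum_unordered_pairs) (auto simp: R_def h_def)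
  also have "(\<Sum>(i, j)\<in>R. h i j) = (\<Sum>i=1..<k. h i (k - i))"
    by (rule sum.reindex_bij_witness[of _ "\<lambda>i. (i, k - i)" fst]) (auto simp: R_def)
  also have "\<dots> / 2 = (\<Sum>i=1..<k. gibbs_weight a b i * gibbs_weight a b (k - i)) * (real k * a + b) / 2 / gibbs_weight a b k"
    unfolding h_def sum_distrib_right[symmetric] by simp
  also have "\<dots> = 1 * (real k - 1)"
    unfolding gibbs_weight_convolution[OF k] using pos[of k] by simp
  finally show ?thesis .
qed

section \<open>Equations (A) and (B) for the Gibbs layers\<close>

lemma sum_neighbours_coag:
  "(\<Sum>\<zeta>\<in>{\<zeta> \<in> Omega_groups N r. neighbours \<zeta> \<eta>}. f \<zeta> * coag_rate N \<psi> \<zeta> \<eta>)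
    = (\<Sum>\<zeta>\<in>Omega_groups N r. f \<zeta> * coag_rate N \<psi> \<zeta> \<eta>)"
  by (rule sum.mono_neutral_left) (auto dest: coag_rate_neighbours)

lemma sum_neighbours_frag:
  "(\<Sum>\<eta>\<in>{\<eta> \<in> Omega_groups N r. neighbours \<eta> \<zeta>}. f \<eta> * frag_rate N \<phi> \<eta> \<zeta>)
    = (\<Sum>\<eta>\<in>Omega_groups N r. f \<eta> * frag_rate N \<phi> \<eta> \<zeta>)"
  by (rule sum.mono_neutral_left) (auto dest: frag_rate_neighbours)

context
  fixes a b :: real
  assumes a: "0 \<le> a" and ab: "0 < 2 * a + b"
begin

text \<open>Detailed balance turns the sum over all coagulations into \<eta> into the row sum of
  fragmentations out of \<eta>, which is N - r; \<open>gibbs_norm_Suc\<close> exchanges this for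
  \<open>mu\<close> times a ratio of normalisers.\<close>

lemma gibbs_coag_balance:
  assumes \<psi>: "\<forall>i\<ge>1. \<forall>j\<ge>1. \<psi> i j = a * (real i + real j) + b"
    and r: "1 \<le> r" "r < N" and \<eta>: "\<eta> \<in> Omega_groups N r"
  shows "(\<Sum>\<zeta>\<in>Omega_groups N (Suc r). gibbs_measure a b N \<zeta> / gibbs_norm a b N (Suc r) * coag_rate N \<psi> \<zeta> \<eta>)
    = mu a b N (Suc r) * (gibbs_measure a b N \<eta> / gibbs_norm a b N r)"
proof -
  note pos = gibbs_weight_pos[OF a ab]
  have D: "real N - real r = gibbs_norm a b N (Suc r) * mu a b N (Suc r) / gibbs_norm a b N r"
    using gibbs_norm_Suc[OF r(2), of a b] gibbs_norm_pos[OF a ab r(1), of N]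
    by (simp add: eq_divide_eq mult.commute)
  have "(\<Sum>\<zeta>\<in>Omega_groups N (Suc r). gibbs_measure a b N \<zeta> / gibbs_norm a b N (Suc r) * coag_rate N \<psi> \<zeta> \<eta>)
      = (\<Sum>\<zeta>\<in>Omega_groups N (Suc r). gibbs_measure a b N \<eta> / gibbs_norm a b N (Suc r) * frag_rate N (gibbs_frag a b) \<eta> \<zeta>)"
    by (intro sum.cong refl) (simp add: gibbs_detailed_balance[OF pos \<psi>])
  also have "\<dots> = gibbs_measure a b N \<eta> / gibbs_norm a b N (Suc r) * (real N - real r)"
    unfolding sum_distrib_left[symmetric] frag_rate_row[OF \<eta>]
    using total_frag_rate[of "gibbs_frag a b" 1, OF gibbs_frag_sum[OF pos] \<eta>] by simp
  also have "\<dots> = mu a b N (Suc r) * (gibbs_measure a b N \<eta> / gibbs_norm a b N r)"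
    unfolding D using gibbs_norm_pos[OF a ab, of "Suc r" N] by simp
  finally show ?thesis .
qed

text \<open>The mirror image: the sum over fragmentations into \<zeta> becomes the row sum of
  coagulations out of \<zeta>, which is \<open>mu\<close>. The coagulation kernel is absent from the
  statement and enters only as the reversal.\<close>

lemma gibbs_frag_balance:
  assumes r: "1 \<le> r" "r < N" and \<zeta>: "\<zeta> \<in> Omega_groups N (Suc r)"
  shows "(\<Sum>\<eta>\<in>Omega_groups N r. gibbs_measure a b N \<eta> / gibbs_norm a b N r * frag_rate N (gibbs_frag a b) \<eta> \<zeta>)
    = (real N - real r) * (gibbs_measure a b N \<zeta> / gibbs_norm a b N (Suc r))"
proof -
  note pos = gibbs_weight_pos[OF a ab]
  have D: "real N - real r = gibbs_norm a b N (Suc r) * mu a b N (Suc r) / gibbs_norm a b N r"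
    using gibbs_norm_Suc[OF r(2), of a b] gibbs_norm_pos[OF a ab r(1), of N]
    by (simp add: eq_divide_eq mult.commute)
  define \<psi> where "\<psi> i j = a * (real i + real j) + b" for i j
  have \<psi>: "\<forall>i\<ge>1. \<forall>j\<ge>1. \<psi> i j = a * (real i + real j) + b" by (simp add: \<psi>_def)
  have "(\<Sum>\<eta>\<in>Omega_groups N r. gibbs_measure a b N \<eta> / gibbs_norm a b N r * frag_rate N (gibbs_frag a b) \<eta> \<zeta>)
      = (\<Sum>\<eta>\<in>Omega_groups N r. gibbs_measure a b N \<zeta> / gibbs_norm a b N r * coag_rate N \<psi> \<zeta> \<eta>)"
    by (intro sum.cong refl) (simp add: gibbs_detailed_balance[OF pos \<psi>])
  also have "\<dots> = gibbs_measure a b N \<zeta> / gibbs_norm a b N r * mu a b N (Suc r)"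
    unfolding sum_distrib_left[symmetric] coag_rate_row[OF \<zeta>] total_coag_rate[OF \<psi> \<zeta>] by simp
  also have "\<dots> = (real N - real r) * (gibbs_measure a b N \<zeta> / gibbs_norm a b N (Suc r))"
    unfolding D using gibbs_norm_pos[OF a ab, of "Suc r" N] by simp
  finally show ?thesis .
qed

end

section \<open>The two singleton layers\<close>

lemma Omega_groups_single:
  assumes "1 \<le> N"
  shows "Omega_groups N 1 = {\<lambda>k. of_bool (k = N)}"
proof (intro equalityI subsetI)
  fix \<eta> assume \<eta>: "\<eta> \<in> Omega_groups N 1"
  then have "(\<Sum>k=1..N. \<eta> k) = 1" by (simp add: Omega_groups_def groups_def)
  then obtain m where m: "m \<in> {1..N}" "\<eta> m = 1" "\<And>k. k \<in> {1..N} \<Longrightarrow> m \<noteq> k \<Longrightarrow> \<eta> k = 0"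
    using sum_eq_1_iff[of "{1..N}" \<eta>] by auto
  have "N = (\<Sum>k=1..N. k * \<eta> k)" using \<eta> by (simp add: Omega_groups_def Omega_def)
  also have "\<dots> = (\<Sum>k\<in>{m}. k * \<eta> k)"
    using m by (intro sum.mono_neutral_right) auto
  finally have "m = N" using m(2) by simp
  moreover have "\<eta> k = 0" if "k \<notin> {1..N}" for k using \<eta> that by (simp add: Omega_groups_def Omega_def)
  ultimately have "\<eta> k = of_bool (k = N)" for k using m(2) m(3)[of k] by (cases "k \<in> {1..N}") auto
  then show "\<eta> \<in> {\<lambda>k. of_bool (k = N)}" by auto
next
  fix \<eta> :: "nat \<Rightarrow> nat" assume "\<eta> \<in> {\<lambda>k. of_bool (k = N)}"
  then show "\<eta> \<in> Omega_groups N 1"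
    using assms by (auto simp: Omega_groups_def Omega_def groups_def of_bool_def if_distrib sum.delta cong: if_cong)
qed

lemma Omega_groups_full:
  assumes "1 \<le> N"
  shows "Omega_groups N N = {\<lambda>k. if k = 1 then N else 0}"
proof (intro equalityI subsetI)
  fix \<eta> assume \<eta>: "\<eta> \<in> Omega_groups N N"
  have sums: "(\<Sum>k=1..N. \<eta> k) = N" "(\<Sum>k=1..N. k * \<eta> k) = N"
    using \<eta> by (simp_all add: Omega_groups_def Omega_def groups_def)
  \<comment> \<open>The sum of (k - 1) n_k is the mass minus the number of groups, here 0, which
    leaves only groups of size 1.\<close>
  have "(\<Sum>k=1..N. (k - 1) * \<eta> k) + (\<Sum>k=1..N. \<eta> k) = (\<Sum>k=1..N. k * \<eta> k)"
    unfolding sum.distrib[symmetric] by (intro sum.cong refl) (auto simp: diff_mult_distrib)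
  then have "(\<Sum>k=1..N. (k - 1) * \<eta> k) = 0" using sums by simp
  then have "\<forall>k\<in>{1..N}. k \<le> 1 \<or> \<eta> k = 0" by simp
  moreover have "\<not> k \<le> 1" if "k \<in> {1..N}" "k \<noteq> 1" for k
    using that by simp
  ultimately have 0: "\<eta> k = 0" if "k \<in> {1..N}" "k \<noteq> 1" for k
    using that by blast
  have "(\<Sum>k=1..N. \<eta> k) = (\<Sum>k\<in>{1}. \<eta> k)"
    using 0 assms by (intro sum.mono_neutral_right) auto
  then have "\<eta> 1 = N" using sums by simp
  moreover have "\<eta> k = 0" if "k \<notin> {1..N}" for k using \<eta> that by (simp add: Omega_groups_def Omega_def)
  ultimately have "\<eta> k = (if k = 1 then N else 0)" for k using 0[of k] by (cases "k \<in> {1..N}") auto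
  then show "\<eta> \<in> {\<lambda>k. if k = 1 then N else 0}" by auto
next
  fix \<eta> :: "nat \<Rightarrow> nat" assume "\<eta> \<in> {\<lambda>k. if k = 1 then N else 0}"
  then show "\<eta> \<in> Omega_groups N N"
    using assms by (auto simp: Omega_groups_def Omega_def groups_def if_distrib sum.delta cong: if_cong)
qed

lemma gibbs_measure_single: "1 \<le> N \<Longrightarrow> gibbs_measure a b N (\<lambda>k. of_bool (k = N)) = gibbs_weight a b N"
  unfolding gibbs_measure_def
  by (subst prod.remove[of _ N]) auto

lemma gibbs_measure_full: "1 \<le> N \<Longrightarrow> gibbs_measure a b N (\<lambda>k. if k = 1 then N else 0) = 1 / fact N"
  unfolding gibbs_measure_def
  by (subst prod.remove[of _ 1]) (auto simp: gibbs_weight_def)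

lemma gibbs_norm_full: "gibbs_norm a b N N = 1 / fact N"
  by (simp add: gibbs_norm_def)

text \<open>The factors l - 1 multiply to (N - 1)! and cancel the second factorial of the
  denominator, leaving the product that defines the weight.\<close>

lemma gibbs_norm_single:
  assumes "1 \<le> N"
  shows "gibbs_norm a b N 1 = gibbs_weight a b N"
proof -
  have "(\<Prod>l=2..N. (real l - 1) / 2 * (2 * a * real N + real l * b))
      = (\<Prod>l=2..N. real l - 1) * (\<Prod>l=2..N. real N * a + b * real l / 2)"
    unfolding prod.distrib[symmetric] by (intro prod.cong refl) (simp add: field_simps)
  also have "(\<Prod>l=2..N. real l - 1) = (\<Prod>l=1..N-1. real l)"
    by (rule prod.reindex_bij_witness[of _ Suc "\<lambda>l. l - 1"]) auto
  also have "\<dots> = fact (N - 1)"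
    by (simp add: fact_prod)
  finally show ?thesis
    by (simp add: gibbs_norm_def gibbs_weight_def numeral_2_eq_2)
qed

lemma pmf_eq_1_if_singleton: "set_pmf p \<subseteq> {x} \<Longrightarrow> pmf p x = 1"
  by (simp add: set_pmf_subset_singleton)

section \<open>Recursive determination of the layers\<close>

lemma gibbs_layers_if_coag_balance:
  assumes a: "0 \<le> a" and ab: "0 < 2 * a + b" and N: "1 \<le> N"
    and \<psi>: "\<forall>i\<ge>1. \<forall>j\<ge>1. \<psi> i j = a * (real i + real j) + b"
    and layers: "layer_distributions N \<rho>" and bal: "coag_balance a b \<psi> N \<rho>"
  shows "gibbs_layers a b N \<rho>"
proof -
  have "\<forall>\<eta>\<in>Omega_groups N r. pmf (\<rho> r) \<eta> = gibbs_measure a b N \<eta> / gibbs_norm a b N r"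
    if "r \<le> N" "1 \<le> r" for r
    using that
  proof (induction r rule: inc_induct)
    case base
    have "set_pmf (\<rho> N) \<subseteq> Omega_groups N N" using layers N by (simp add: layer_distributions_def)
    then show ?case
      using N by (simp add: Omega_groups_full pmf_eq_1_if_singleton gibbs_measure_full[OF N, simplified] gibbs_norm_full)
  next
    case (step r)
    show ?case
    proof
      fix \<eta> assume \<eta>: "\<eta> \<in> Omega_groups N r"
      have "mu a b N (Suc r) * pmf (\<rho> r) \<eta> = (\<Sum>\<zeta>\<in>Omega_groups N (Suc r). pmf (\<rho> (Suc r)) \<zeta> * coag_rate N \<psi> \<zeta> \<eta>)"
        using bal \<eta> step.hyps step.prems by (simp add: coag_balance_def sum_neighbours_coag)
      also have "\<dots> = (\<Sum>\<zeta>\<in>Omega_groups N (Suc r). gibbs_measure a b N \<zeta> / gibbs_norm a b N (Suc r) * coag_rate N \<psi> \<zeta> \<eta>)"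
        using step.IH by (intro sum.cong refl) simp
      also have "\<dots> = mu a b N (Suc r) * (gibbs_measure a b N \<eta> / gibbs_norm a b N r)"
        using step.hyps step.prems \<eta> by (intro gibbs_coag_balance[OF a ab \<psi>]) auto
      finally have "mu a b N (Suc r) * pmf (\<rho> r) \<eta> = mu a b N (Suc r) * (gibbs_measure a b N \<eta> / gibbs_norm a b N r)" .
      \<comment> \<open>A nonzero death rate allows (A) to be solved for the lower layer.\<close>
      moreover have "mu a b N (Suc r) \<noteq> 0"
        using mu_pos[OF a ab, of "Suc r" N] step.hyps step.prems by auto
      ultimately show "pmf (\<rho> r) \<eta> = gibbs_measure a b N \<eta> / gibbs_norm a b N r"
        using mult_left_cancel by blast
    qed
  qed
  then show ?thesis by (auto simp: gibbs_layers_iff)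
qed

lemma gibbs_layers_if_frag_balance:
  assumes a: "0 \<le> a" and ab: "0 < 2 * a + b" and N: "1 \<le> N" and c: "0 < \<phi> 1 1"
    and \<phi>: "\<And>i j. 1 \<le> i \<Longrightarrow> i \<le> j \<Longrightarrow> \<phi> i j = \<phi> 1 1 * gibbs_frag a b i j"
    and layers: "layer_distributions N \<rho>" and bal: "frag_balance \<phi> N \<rho>"
  shows "gibbs_layers a b N \<rho>"
proof -
  \<comment> \<open>The fragmentation rate is linear in the kernel and evaluates it only at i \<le>
    j, where proportionality is assumed.\<close>
  have rate: "frag_rate N \<phi> \<eta> \<zeta> = \<phi> 1 1 * frag_rate N (gibbs_frag a b) \<eta> \<zeta>" for \<eta> \<zeta>
    unfolding frag_rate_def sum_distrib_left
  proof (intro sum.cong refl, clarify)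
    fix i j :: nat assume "1 \<le> i" "i \<le> j"
    then show "real (\<eta> (i + j)) * \<phi> i j = \<phi> 1 1 * (real (\<eta> (i + j)) * gibbs_frag a b i j)"
      using \<phi>[of i j] by simp
  qed
  have "\<forall>\<eta>\<in>Omega_groups N r. pmf (\<rho> r) \<eta> = gibbs_measure a b N \<eta> / gibbs_norm a b N r"
    if "1 \<le> r" "r \<le> N" for r
    using that
  proof (induction r rule: dec_induct)
    case base
    have "set_pmf (\<rho> 1) \<subseteq> Omega_groups N 1" using layers N by (simp add: layer_distributions_def)
    then have "pmf (\<rho> 1) (\<lambda>k. of_bool (k = N)) = 1"
      unfolding Omega_groups_single[OF N] by (rule pmf_eq_1_if_singleton)
    then show ?case
      using gibbs_weight_pos[OF a ab, of N]
      unfolding Omega_groups_single[OF N] by (simp add: gibbs_measure_single[OF N] gibbs_norm_single[OF N, simplified])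
  next
    case (step r)
    show ?case
    proof
      fix \<zeta> assume \<zeta>: "\<zeta> \<in> Omega_groups N (Suc r)"
      have "lambda \<phi> N r * pmf (\<rho> (Suc r)) \<zeta> = (\<Sum>\<eta>\<in>Omega_groups N r. pmf (\<rho> r) \<eta> * frag_rate N \<phi> \<eta> \<zeta>)"
        using bal \<zeta> step.hyps step.prems by (simp add: frag_balance_def sum_neighbours_frag)
      also have "\<dots> = \<phi> 1 1 * (\<Sum>\<eta>\<in>Omega_groups N r. gibbs_measure a b N \<eta> / gibbs_norm a b N r * frag_rate N (gibbs_frag a b) \<eta> \<zeta>)"
        unfolding sum_distrib_left rate using step by (intro sum.cong refl) simp
      also have "\<dots> = \<phi> 1 1 * ((real N - real r) * (gibbs_measure a b N \<zeta> / gibbs_norm a b N (Suc r)))"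
        using step.hyps step.prems \<zeta> by (subst gibbs_frag_balance[OF a ab]) auto
      finally have "lambda \<phi> N r * pmf (\<rho> (Suc r)) \<zeta> = lambda \<phi> N r * (gibbs_measure a b N \<zeta> / gibbs_norm a b N (Suc r))"
        by (simp only: lambda_def mult.assoc)
      moreover have "lambda \<phi> N r \<noteq> 0"
        using c step.prems by (simp add: lambda_def)
      ultimately show "pmf (\<rho> (Suc r)) \<zeta> = gibbs_measure a b N \<zeta> / gibbs_norm a b N (Suc r)"
        using mult_left_cancel by blast
    qed
  qed
  then show ?thesis by (auto simp: gibbs_layers_iff)
qed

section \<open>Solvability of (B) and recovery of the fragmentation rates\<close>

lemma embed_pmf_finite:
  fixes f :: "'s \<Rightarrow> real"
  assumes A: "finite A" and f: "\<And>x. x \<in> A \<Longrightarrow> 0 \<le> f x" and sum: "sum f A = 1"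
  obtains p where "set_pmf p \<subseteq> A" and "\<And>x. x \<in> A \<Longrightarrow> pmf p x = f x"
proof -
  define g where "g x = (if x \<in> A then f x else 0)" for x
  have "(\<integral>\<^sup>+ x. ennreal (g x) \<partial>count_space UNIV) = (\<Sum>x\<in>A. ennreal (g x))"
    using A by (intro nn_integral_count_space') (auto simp: g_def)
  also have "\<dots> = ennreal (sum g A)"
    by (rule sum_ennreal) (simp add: g_def f)
  also have "sum g A = 1"
    using sum by (simp add: g_def)
  finally have pmf: "pmf (embed_pmf g) x = g x" for x
    by (intro pmf_embed_pmf) (auto simp: g_def f)
  have "set_pmf (embed_pmf g) \<subseteq> A"
    by (auto simp: set_pmf_iff pmf g_def split: if_splits)
  moreover have "pmf (embed_pmf g) x = f x" if "x \<in> A" for x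
    using that by (simp add: pmf g_def)
  ultimately show ?thesis by (rule that)
qed

text \<open>Layer r + 1 is defined from layer r by (B) itself. All states of layer r have the same
  total fragmentation rate \<open>lambda\<close>, so the new weights sum to 1.\<close>

lemma frag_balance_solution:
  fixes \<phi> :: "nat \<Rightarrow> nat \<Rightarrow> real"
  assumes N: "1 \<le> N" and c: "0 < \<phi> 1 1" and nonneg: "\<forall>i\<ge>1. \<forall>j\<ge>1. 0 \<le> \<phi> i j"
    and \<phi>: "\<And>k. 1 \<le> k \<Longrightarrow> (\<Sum>(i, j)\<in>{(i, j). 1 \<le> i \<and> i \<le> j \<and> i + j = k}. \<phi> i j) = \<phi> 1 1 * (real k - 1)"
  obtains \<rho> where "layer_distributions N \<rho>" and "frag_balance \<phi> N \<rho>"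
proof -
  have rate_nonneg: "0 \<le> frag_rate N \<phi> \<eta> \<zeta>" for \<eta> \<zeta>
    unfolding frag_rate_eq using nonneg by (intro sum_nonneg) (auto simp: pairs_def)
  define step where "step r p p' \<longleftrightarrow> (\<forall>\<zeta>\<in>Omega_groups N (Suc r).
      lambda \<phi> N r * pmf p' \<zeta> = (\<Sum>\<eta>\<in>Omega_groups N r. pmf p \<eta> * frag_rate N \<phi> \<eta> \<zeta>))" for r p p'
  \<comment> \<open>Index n stands for layer n + 1. Dependent choice asks for a successor at every
    n, so all requirements are guarded and become empty beyond layer N.\<close>
  have "\<exists>p'. (Suc (Suc n) \<le> N \<longrightarrow> set_pmf p' \<subseteq> Omega_groups N (Suc (Suc n))) \<and> (Suc n < N \<longrightarrow> step (Suc n) p p')"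
    if p: "Suc n \<le> N \<longrightarrow> set_pmf p \<subseteq> Omega_groups N (Suc n)" for n p
  proof (cases "Suc n < N")
    case True
    define r where "r = Suc n"
    have r: "r < N" and pr: "set_pmf p \<subseteq> Omega_groups N r" using True p by (simp_all add: r_def)
    have pos: "0 < lambda \<phi> N r" using c r by (simp add: lambda_def)
    define f where "f \<zeta> = (\<Sum>\<eta>\<in>Omega_groups N r. pmf p \<eta> * frag_rate N \<phi> \<eta> \<zeta>) / lambda \<phi> N r" for \<zeta>
    have "(\<Sum>\<zeta>\<in>Omega_groups N (Suc r). \<Sum>\<eta>\<in>Omega_groups N r. pmf p \<eta> * frag_rate N \<phi> \<eta> \<zeta>)
        = (\<Sum>\<eta>\<in>Omega_groups N r. pmf p \<eta> * (\<Sum>\<zeta>\<in>Omega_groups N (Suc r). frag_rate N \<phi> \<eta> \<zeta>))"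
      unfolding sum_distrib_left by (rule sum.swap)
    also have "\<dots> = (\<Sum>\<eta>\<in>Omega_groups N r. pmf p \<eta> * lambda \<phi> N r)"
      by (intro sum.cong refl) (simp only: frag_rate_row total_frag_rate[OF \<phi>] lambda_def)
    also have "\<dots> = lambda \<phi> N r"
      using pr by (simp add: sum_pmf_eq_1 flip: sum_distrib_right)
    finally have "sum f (Omega_groups N (Suc r)) = 1"
      unfolding f_def sum_divide_distrib[symmetric] using pos by simp
    moreover have "0 \<le> f \<zeta>" for \<zeta>
      unfolding f_def using pos rate_nonneg by (intro divide_nonneg_nonneg sum_nonneg) auto
    ultimately obtain p' where p': "set_pmf p' \<subseteq> Omega_groups N (Suc r)"
        "\<And>\<zeta>. \<zeta> \<in> Omega_groups N (Suc r) \<Longrightarrow> pmf p' \<zeta> = f \<zeta>"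
      using embed_pmf_finite[OF finite_Omega_groups, of N "Suc r" f] by blast
    then have "step r p p'" using pos by (simp add: step_def f_def)
    then show ?thesis using p'(1) unfolding r_def by blast
  qed auto
  moreover have "\<exists>p. Suc 0 \<le> N \<longrightarrow> set_pmf p \<subseteq> Omega_groups N (Suc 0)"
    using Omega_groups_single[OF N] by (intro exI[of _ "return_pmf (\<lambda>k. of_bool (k = N))"]) simp
  ultimately obtain f where f: "\<And>n. Suc n \<le> N \<longrightarrow> set_pmf (f n) \<subseteq> Omega_groups N (Suc n)"
      "\<And>n. Suc n < N \<longrightarrow> step (Suc n) (f n) (f (Suc n))"
    using dependent_nat_choice[of "\<lambda>n p. Suc n \<le> N \<longrightarrow> set_pmf p \<subseteq> Omega_groups N (Suc n)"
        "\<lambda>n p p'. Suc n < N \<longrightarrow> step (Suc n) p p'"] by metis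
  show ?thesis
  proof (rule that[of "\<lambda>r. f (r - 1)"])
    show "layer_distributions N (\<lambda>r. f (r - 1))"
      unfolding layer_distributions_def
    proof
      fix r assume "r \<in> {1..N}"
      then show "set_pmf (f (r - 1)) \<subseteq> Omega_groups N r" using f(1)[of "r - 1"] by simp
    qed
    show "frag_balance \<phi> N (\<lambda>r. f (r - 1))"
      unfolding frag_balance_def sum_neighbours_frag
    proof
      fix r assume "r \<in> {1..<N}"
      then show "\<forall>\<zeta>\<in>Omega_groups N (r + 1). lambda \<phi> N r * pmf (f (r + 1 - 1)) \<zeta> =
          (\<Sum>\<eta>\<in>Omega_groups N r. pmf (f (r - 1)) \<eta> * frag_rate N \<phi> \<eta> \<zeta>)"
        using f(2)[of "r - 1"] by (simp add: step_def)
    qed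
  qed
qed

text \<open>The state after splitting a lone group displays both fragment sizes, so with i \<le> j a
  single pair contributes, and there is exactly one group to split.\<close>

lemma frag_rate_single:
  assumes ij: "1 \<le> i" "i \<le> j"
  defines "\<delta> \<equiv> \<lambda>k. of_bool (k = i + j)"
  shows "frag_rate (i + j) \<phi> \<delta> (frag i j \<delta>) = \<phi> i j"
proof -
  have "{(i', j'). 1 \<le> i' \<and> i' \<le> j' \<and> i' + j' \<le> i + j \<and> can_frag i' j' \<delta> \<and> frag i j \<delta> = frag i' j' \<delta>} = {(i, j)}"
  proof (intro equalityI subsetI; clarsimp)
    fix i' j' assume h: "i' \<le> j'" "can_frag i' j' \<delta>" and eq: "frag i j \<delta> = frag i' j' \<delta>"
    have s: "i' + j' = i + j" "1 \<le> i'" using h(2) by (auto simp: can_frag_def \<delta>_def of_bool_def split: if_splits)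
    have "frag i j \<delta> i = frag i' j' \<delta> i" using eq by simp
    then have "i = i' \<or> i = j'" using ij s by (auto simp: frag_def \<delta>_def of_bool_def split: if_splits)
    then show "i' = i \<and> j' = j" using s h(1) ij by auto
  next
    show "Suc 0 \<le> i \<and> i \<le> j \<and> can_frag i j \<delta>" using ij by (simp add: can_frag_def \<delta>_def)
  qed
  then show ?thesis by (simp add: frag_rate_def \<delta>_def)
qed

text \<open>For N = i + j the lone group reaches a two-group state with probability equal to the
  rate of that split over the total rate. The kernels \<open>\<phi>\<close> and
  \<open>gibbs_frag\<close> give the same probability and have total rates \<open>\<phi> 1 1\<close>
  (N - 1) and N - 1, hence differ by the factor \<open>\<phi> 1 1\<close>.\<close>

lemma frag_rates_if_gibbs_layers:
  fixes \<phi> :: "nat \<Rightarrow> nat \<Rightarrow> real"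
  assumes a: "0 \<le> a" and ab: "0 < 2 * a + b" and c: "0 < \<phi> 1 1" and nonneg: "\<forall>i\<ge>1. \<forall>j\<ge>1. 0 \<le> \<phi> i j"
    and \<phi>: "\<And>k. 1 \<le> k \<Longrightarrow> (\<Sum>(i, j)\<in>{(i, j). 1 \<le> i \<and> i \<le> j \<and> i + j = k}. \<phi> i j) = \<phi> 1 1 * (real k - 1)"
    and ij: "1 \<le> i" "i \<le> j"
    and gibbs: "\<And>\<rho>. layer_distributions (i + j) \<rho> \<Longrightarrow> frag_balance \<phi> (i + j) \<rho> \<Longrightarrow> gibbs_layers a b (i + j) \<rho>"
  shows "\<phi> i j = \<phi> 1 1 * gibbs_frag a b i j"
proof -
  define N where "N = i + j"
  have N: "1 \<le> N" "1 < N" using ij by (simp_all add: N_def)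
  define \<delta> :: "nat \<Rightarrow> nat" where "\<delta> = (\<lambda>k. of_bool (k = N))"
  define \<zeta> where "\<zeta> = frag i j \<delta>"
  have single: "Omega_groups N 1 = {\<delta>}" unfolding \<delta>_def by (rule Omega_groups_single[OF N(1)])
  have \<zeta>: "\<zeta> \<in> Omega_groups N (Suc 1)"
    unfolding \<zeta>_def by (rule frag_in_layer) (use single ij in \<open>simp_all add: can_frag_def \<delta>_def N_def\<close>)
  obtain \<rho> where \<rho>: "layer_distributions N \<rho>" "frag_balance \<phi> N \<rho>"
    using frag_balance_solution[OF N(1) c nonneg \<phi>] by blast
  have g: "gibbs_layers a b N \<rho>" using gibbs \<rho> by (simp add: N_def)
  have "set_pmf (\<rho> 1) \<subseteq> {\<delta>}"
    using \<rho>(1) N(1) unfolding single[symmetric] layer_distributions_def by simp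
  then have p1: "pmf (\<rho> 1) \<delta> = 1"
    by (rule pmf_eq_1_if_singleton)
  have rate: "frag_rate N f \<delta> \<zeta> = f i j" for f
    unfolding N_def \<zeta>_def \<delta>_def by (rule frag_rate_single[OF ij])
  have "lambda \<phi> N 1 * pmf (\<rho> (Suc 1)) \<zeta> = (\<Sum>\<eta>\<in>Omega_groups N 1. pmf (\<rho> 1) \<eta> * frag_rate N \<phi> \<eta> \<zeta>)"
    using \<rho>(2) N \<zeta> by (simp add: frag_balance_def sum_neighbours_frag)
  then have 1: "lambda \<phi> N 1 * pmf (\<rho> (Suc 1)) \<zeta> = \<phi> i j"
    unfolding single by (simp add: p1[simplified] rate)
  have "(real N - real 1) * (gibbs_measure a b N \<zeta> / gibbs_norm a b N (Suc 1)) =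
      (\<Sum>\<eta>\<in>Omega_groups N 1. gibbs_measure a b N \<eta> / gibbs_norm a b N 1 * frag_rate N (gibbs_frag a b) \<eta> \<zeta>)"
    using N(2) \<zeta> by (intro gibbs_frag_balance[OF a ab, symmetric]) auto
  also have "\<dots> = gibbs_measure a b N \<delta> / gibbs_norm a b N 1 * gibbs_frag a b i j"
    unfolding single by (simp add: rate)
  also have "gibbs_measure a b N \<delta> / gibbs_norm a b N 1 = 1"
    using gibbs_weight_pos[OF a ab, of N] by (simp add: \<delta>_def gibbs_measure_single[OF N(1)] gibbs_norm_single[OF N(1), simplified])
  finally have 2: "(real N - real 1) * (gibbs_measure a b N \<zeta> / gibbs_norm a b N (Suc 1)) = gibbs_frag a b i j"
    by simp
  have 3: "pmf (\<rho> (Suc 1)) \<zeta> = gibbs_measure a b N \<zeta> / gibbs_norm a b N (Suc 1)"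
    using g \<zeta> N(2) by (simp add: gibbs_layers_iff)
  show ?thesis
    unfolding 1[symmetric] 2[symmetric] 3 lambda_def by (rule mult.assoc)
qed

section \<open>The number of groups as a lumping of the process\<close>

lemma cfp_lumping:
  assumes N: "1 \<le> N"
    and \<psi>: "\<forall>i\<ge>1. \<forall>j\<ge>1. \<psi> i j = a * (real i + real j) + b"
    and \<phi>: "\<And>k. 1 \<le> k \<Longrightarrow> (\<Sum>(i, j)\<in>{(i, j). 1 \<le> i \<and> i \<le> j \<and> i + j = k}. \<phi> i j) = \<phi> 1 1 * (real k - 1)"
    and layers: "layer_distributions N \<rho>"
    and coag: "coag_balance a b \<psi> N \<rho>" and frag: "frag_balance \<phi> N \<rho>"
  shows "lumping (Omega N) {1..N} (groups N) (cfp_rate N \<psi> \<phi>) (birth_death_rate (lambda \<phi> N) (mu a b N)) \<rho>"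
proof
  have layer: "{\<eta> \<in> Omega N. groups N \<eta> = r} = Omega_groups N r" for r
    by (simp add: Omega_groups_def)
  \<comment> \<open>Every jump changes the number of groups by one, upwards only by fragmentation
    and downwards only by coagulation, so between two layers at most one of the two rates
    survives.\<close>
  have coag_0: "coag_rate N \<psi> \<eta> \<zeta> = 0" if "groups N \<eta> \<noteq> groups N \<zeta> + 1" for \<eta> \<zeta>
    using that coag_rate_groups by blast
  have frag_0: "frag_rate N \<phi> \<eta> \<zeta> = 0" if "groups N \<zeta> \<noteq> groups N \<eta> + 1" for \<eta> \<zeta>
    using that frag_rate_groups by blast
  have rate_0: "cfp_rate N \<psi> \<phi> \<eta> \<zeta> = 0"
    if "groups N \<zeta> \<noteq> groups N \<eta> + 1" "groups N \<eta> \<noteq> groups N \<zeta> + 1" for \<eta> \<zeta>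
    using that by (simp add: cfp_rate_def coag_0 frag_0)
  have rate_frag: "cfp_rate N \<psi> \<phi> \<eta> \<zeta> = frag_rate N \<phi> \<eta> \<zeta>" if "groups N \<zeta> = groups N \<eta> + 1" for \<eta> \<zeta>
    using that by (simp add: cfp_rate_def coag_0)
  have rate_coag: "cfp_rate N \<psi> \<phi> \<eta> \<zeta> = coag_rate N \<psi> \<eta> \<zeta>" if "groups N \<eta> = groups N \<zeta> + 1" for \<eta> \<zeta>
    using that by (simp add: cfp_rate_def frag_0)
  show "finite (Omega N)" "finite {1..N}" by simp_all
  show range: "groups N \<eta> \<in> {1..N}" if "\<eta> \<in> Omega N" for \<eta>
  proof -
    have sum: "(\<Sum>i=1..N. i * \<eta> i) = N" using that by (simp add: Omega_def)
    have "groups N \<eta> \<le> (\<Sum>i=1..N. i * \<eta> i)"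
      unfolding groups_def by (rule sum_mono) simp
    moreover have "groups N \<eta> \<noteq> 0"
    proof
      assume "groups N \<eta> = 0"
      then have "(\<Sum>i=1..N. i * \<eta> i) = 0" by (simp add: groups_def)
      then show False using sum N by simp
    qed
    ultimately show ?thesis unfolding sum by simp
  qed
  show "set_pmf (\<rho> r) \<subseteq> {\<eta> \<in> Omega N. groups N \<eta> = r}" if "r \<in> {1..N}" for r
    unfolding layer using layers that by (simp add: layer_distributions_def)
  show "cfp_rate N \<psi> \<phi> \<eta> \<zeta> = 0" if "groups N \<eta> = groups N \<zeta>" for \<eta> \<zeta>
    by (rule rate_0) (use that in auto)
  show "(\<Sum>\<zeta>\<in>{\<zeta> \<in> Omega N. groups N \<zeta> = s}. cfp_rate N \<psi> \<phi> \<eta> \<zeta>)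
      = birth_death_rate (lambda \<phi> N) (mu a b N) (groups N \<eta>) s"
    if \<eta>: "\<eta> \<in> Omega N" and s: "s \<in> {1..N}" and "s \<noteq> groups N \<eta>" for \<eta> s
  proof -
    define r where "r = groups N \<eta>"
    have \<eta>r: "\<eta> \<in> Omega_groups N r" using \<eta> by (simp add: Omega_groups_def r_def)
    have groups: "groups N \<zeta> = s" if "\<zeta> \<in> Omega_groups N s" for \<zeta>
      using that by (simp add: Omega_groups_def)
    consider "s = r + 1" | "r = s + 1" | "s \<noteq> r + 1" "r \<noteq> s + 1" by blast
    then show ?thesis
    proof cases
      case 1
      have "(\<Sum>\<zeta>\<in>Omega_groups N s. cfp_rate N \<psi> \<phi> \<eta> \<zeta>) = (\<Sum>\<zeta>\<in>Omega_groups N (Suc r). frag_rate N \<phi> \<eta> \<zeta>)"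
        using 1 groups by (intro sum.cong) (auto simp: rate_frag r_def)
      then show ?thesis
        using 1 frag_rate_row[OF \<eta>r] total_frag_rate[OF \<phi> \<eta>r]
        by (simp add: layer birth_death_rate_def lambda_def r_def)
    next
      case 2
      have "(\<Sum>\<zeta>\<in>Omega_groups N s. cfp_rate N \<psi> \<phi> \<eta> \<zeta>) = (\<Sum>\<zeta>\<in>Omega_groups N s. coag_rate N \<psi> \<eta> \<zeta>)"
        using 2 groups by (intro sum.cong) (auto simp: rate_coag r_def)
      then show ?thesis
        using 2 coag_rate_row[of \<eta> N s \<psi>] \<eta>r total_coag_rate[OF \<psi> \<eta>r]
        by (simp add: layer birth_death_rate_def flip: r_def)
    next
      case 3
      then have "(\<Sum>\<zeta>\<in>Omega_groups N s. cfp_rate N \<psi> \<phi> \<eta> \<zeta>) = 0"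
        using groups by (intro sum.neutral ballI rate_0) (auto simp: r_def)
      then show ?thesis
        using 3 by (simp add: layer birth_death_rate_def flip: r_def)
    qed
  qed
  \<comment> \<open>Towards one group more this is (B), towards one group fewer it is (A); all other
    pairs of layers do not communicate.\<close>
  show "(\<Sum>\<zeta>\<in>{\<zeta> \<in> Omega N. groups N \<zeta> = r}. pmf (\<rho> r) \<zeta> * cfp_rate N \<psi> \<phi> \<zeta> \<eta>)
      = birth_death_rate (lambda \<phi> N) (mu a b N) r (groups N \<eta>) * pmf (\<rho> (groups N \<eta>)) \<eta>"
    if r: "r \<in> {1..N}" and \<eta>: "\<eta> \<in> Omega N" and "groups N \<eta> \<noteq> r" for r \<eta>
  proof -
    define s where "s = groups N \<eta>"
    have \<eta>s: "\<eta> \<in> Omega_groups N s" and s: "s \<in> {1..N}"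
      using \<eta> range by (simp_all add: Omega_groups_def s_def)
    have groups: "groups N \<zeta> = r" if "\<zeta> \<in> Omega_groups N r" for \<zeta>
      using that by (simp add: Omega_groups_def)
    consider "s = r + 1" | "r = s + 1" | "s \<noteq> r + 1" "r \<noteq> s + 1" by blast
    then show ?thesis
    proof cases
      case 1
      have "(\<Sum>\<zeta>\<in>Omega_groups N r. pmf (\<rho> r) \<zeta> * cfp_rate N \<psi> \<phi> \<zeta> \<eta>)
          = (\<Sum>\<zeta>\<in>Omega_groups N r. pmf (\<rho> r) \<zeta> * frag_rate N \<phi> \<zeta> \<eta>)"
        using 1 groups by (intro sum.cong) (auto simp: rate_frag s_def)
      moreover have "lambda \<phi> N r * pmf (\<rho> s) \<eta> = (\<Sum>\<zeta>\<in>Omega_groups N r. pmf (\<rho> r) \<zeta> * frag_rate N \<phi> \<zeta> \<eta>)"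
        using frag r s \<eta>s 1 by (simp add: frag_balance_def sum_neighbours_frag)
      ultimately show ?thesis
        using 1 by (simp add: layer birth_death_rate_def flip: s_def)
    next
      case 2
      have "(\<Sum>\<zeta>\<in>Omega_groups N r. pmf (\<rho> r) \<zeta> * cfp_rate N \<psi> \<phi> \<zeta> \<eta>)
          = (\<Sum>\<zeta>\<in>Omega_groups N r. pmf (\<rho> r) \<zeta> * coag_rate N \<psi> \<zeta> \<eta>)"
        using 2 groups by (intro sum.cong) (auto simp: rate_coag s_def)
      moreover have "mu a b N r * pmf (\<rho> s) \<eta> = (\<Sum>\<zeta>\<in>Omega_groups N r. pmf (\<rho> r) \<zeta> * coag_rate N \<psi> \<zeta> \<eta>)"
        using coag r s \<eta>s 2 by (simp add: coag_balance_def sum_neighbours_coag)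
      ultimately show ?thesis
        using 2 by (simp add: layer birth_death_rate_def flip: s_def)
    next
      case 3
      then have "(\<Sum>\<zeta>\<in>Omega_groups N r. pmf (\<rho> r) \<zeta> * cfp_rate N \<psi> \<phi> \<zeta> \<eta>) = 0"
        using groups by (intro sum.neutral ballI mult_eq_0_iff[THEN iffD2] disjI2 rate_0) (auto simp: s_def)
      then show ?thesis
        using 3 by (simp add: layer birth_death_rate_def flip: s_def)
    qed
  qed
qed

text \<open>The fragmentation rates see the kernel only at i \<le> j; symmetry of
  \<open>\<phi>\<close> and of the Gibbs kernel carries the identity to ordered pairs.\<close>

lemma gibbs_frag_iff:
  assumes sym: "\<forall>i\<ge>1. \<forall>j\<ge>1. \<phi> i j = \<phi> j i \<and> 0 \<le> \<phi> i j"
  shows "(\<forall>i j. 1 \<le> i \<longrightarrow> i \<le> j \<longrightarrow> \<phi> i j = \<phi> 1 1 * gibbs_frag a b i j) \<longleftrightarrow>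
    (\<forall>i\<ge>1. \<forall>j\<ge>1. i \<noteq> j \<longrightarrow>
      \<phi> i j = \<phi> 1 1 * (gibbs_weight a b i * gibbs_weight a b j / gibbs_weight a b (i + j)) * (a * (real i + real j) + b)) \<and>
    (\<forall>i\<ge>1. \<phi> i i = \<phi> 1 1 * ((gibbs_weight a b i)\<^sup>2 / (2 * gibbs_weight a b (2 * i))) * (2 * a * real i + b))"
    (is "?L \<longleftrightarrow> ?R1 \<and> ?R2")
proof
  assume L: ?L
  have "\<phi> i j = \<phi> 1 1 * gibbs_frag a b i j" if "1 \<le> i" "1 \<le> j" for i j
  proof (cases "i \<le> j")
    case True
    then show ?thesis using L that(1) by blast
  next
    case False
    have "\<phi> i j = \<phi> j i" using sym that by blast
    also have "\<dots> = \<phi> 1 1 * gibbs_frag a b j i"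
      using L that(2) nat_le_linear False by blast
    also have "gibbs_frag a b j i = gibbs_frag a b i j"
      using False by (simp add: gibbs_frag_def ac_simps)
    finally show ?thesis .
  qed
  note all = this
  show "?R1 \<and> ?R2"
  proof (intro conjI allI impI)
    fix i j :: nat assume ij: "1 \<le> i" "1 \<le> j" "i \<noteq> j"
    show "\<phi> i j = \<phi> 1 1 * (gibbs_weight a b i * gibbs_weight a b j / gibbs_weight a b (i + j)) * (a * (real i + real j) + b)"
      by (subst all[OF ij(1,2)]) (simp only: gibbs_frag_def if_not_P[OF ij(3)] mult.assoc)
  next
    fix i :: nat assume i: "1 \<le> i"
    show "\<phi> i i = \<phi> 1 1 * ((gibbs_weight a b i)\<^sup>2 / (2 * gibbs_weight a b (2 * i))) * (2 * a * real i + b)"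
      by (subst all[OF i i]) (simp only: gibbs_frag_def if_P mult.assoc)
  qed
next
  assume R: "?R1 \<and> ?R2"
  show ?L
  proof (intro allI impI)
    fix i j :: nat assume ij: "1 \<le> i" "i \<le> j"
    show "\<phi> i j = \<phi> 1 1 * gibbs_frag a b i j"
    proof (cases "i = j")
      case True
      have "\<phi> j j = \<phi> 1 1 * ((gibbs_weight a b j)\<^sup>2 / (2 * gibbs_weight a b (2 * j))) * (2 * a * real j + b)"
        using R ij True by blast
      then show ?thesis unfolding True gibbs_frag_def if_P[OF refl] mult.assoc .
    next
      case False
      have "1 \<le> j" using ij by linarith
      then have "\<phi> i j = \<phi> 1 1 * (gibbs_weight a b i * gibbs_weight a b j / gibbs_weight a b (i + j)) * (a * (real i + real j) + b)"
        using R ij(1) False by blast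
      then show ?thesis unfolding gibbs_frag_def if_not_P[OF False] mult.assoc .
    qed
  qed
qed

theorem theorem1:
  fixes a b :: real and \<psi> \<phi> :: "nat \<Rightarrow> nat \<Rightarrow> real"
  assumes "0 \<le> a" and "0 \<le> 2 * a + b"
    and "\<forall>i\<ge>1. \<forall>j\<ge>1. \<psi> i j = \<psi> j i \<and> 0 \<le> \<psi> i j"
    and "\<forall>i\<ge>1. \<forall>j\<ge>1. \<phi> i j = \<phi> j i \<and> 0 \<le> \<phi> i j"
    and "\<forall>i\<ge>1. \<forall>j\<ge>1. \<psi> i j = a * (real i + real j) + b"
    and "\<forall>k\<ge>1. (\<Sum>(i, j) \<in> {(i, j). 1 \<le> i \<and> i \<le> j \<and> i + j = k}. \<phi> i j) = \<phi> 1 1 * (real k - 1)"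
  shows
    "(\<forall>N\<ge>1. \<forall>\<rho>\<^sub>r. cfp_ergodic N \<psi> \<phi> \<and> layer_distributions N \<rho>\<^sub>r \<and>
          coag_balance a b \<psi> N \<rho>\<^sub>r \<and> frag_balance \<phi> N \<rho>\<^sub>r \<longrightarrow>
        (\<forall>(w :: nat pmf) \<rho> (M :: 'w measure) X.
            set_pmf w \<subseteq> {1..N} \<and> set_pmf \<rho> \<subseteq> Omega N \<and>
            (\<forall>r\<in>{1..N}. \<forall>\<eta>\<in>Omega_groups N r. pmf \<rho> \<eta> = pmf w r * pmf (\<rho>\<^sub>r r) \<eta>) \<and>
            is_cfp M N \<psi> \<phi> \<rho> X \<longrightarrow>
          (\<forall>r\<in>{1..N}. \<forall>\<eta>\<in>Omega_groups N r. \<forall>t\<ge>0.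
             \<P>(\<omega> in M. X t \<omega> = \<eta>) = pmf (\<rho>\<^sub>r r) \<eta> * \<P>(\<omega> in M. groups N (X t \<omega>) = r)) \<and>
          markov_chain M {1..N} (birth_death_rate (lambda \<phi> N) (mu a b N)) w
            (\<lambda>t \<omega>. groups N (X t \<omega>))))
     \<and>
     ((\<forall>i\<ge>1. \<forall>j\<ge>1. 0 < \<psi> i j) \<longrightarrow>
        (\<forall>N\<ge>1. \<forall>\<rho>\<^sub>r. cfp_ergodic N \<psi> \<phi> \<and> layer_distributions N \<rho>\<^sub>r \<and>
            coag_balance a b \<psi> N \<rho>\<^sub>r \<and> frag_balance \<phi> N \<rho>\<^sub>r \<longrightarrow>
          gibbs_layers a b N \<rho>\<^sub>r))
     \<and>
     ((\<forall>i\<ge>1. \<forall>j\<ge>1. \<psi> i j = 0) \<and> 0 < \<phi> 1 1 \<and> (\<forall>N\<ge>1. cfp_ergodic N \<psi> \<phi>) \<longrightarrow>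
        (\<forall>a' b'. 0 \<le> a' \<and> 0 < 2 * a' + b' \<longrightarrow>
          ((\<forall>N\<ge>1. \<forall>\<rho>\<^sub>r. layer_distributions N \<rho>\<^sub>r \<and> frag_balance \<phi> N \<rho>\<^sub>r \<longrightarrow>
              gibbs_layers a' b' N \<rho>\<^sub>r)
           \<longleftrightarrow>
           ((\<forall>i\<ge>1. \<forall>j\<ge>1. i \<noteq> j \<longrightarrow>
               \<phi> i j = \<phi> 1 1 * (gibbs_weight a' b' i * gibbs_weight a' b' j / gibbs_weight a' b' (i + j))
                       * (a' * (real i + real j) + b')) \<and>
            (\<forall>i\<ge>1.
               \<phi> i i = \<phi> 1 1 * ((gibbs_weight a' b' i)\<^sup>2 / (2 * gibbs_weight a' b' (2 * i)))
                       * (2 * a' * real i + b'))))))"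
proof (intro conjI, goal_cases)
  note \<psi> = assms(5)
  have \<phi>: "\<And>k. 1 \<le> k \<Longrightarrow> (\<Sum>(i, j)\<in>{(i, j). 1 \<le> i \<and> i \<le> j \<and> i + j = k}. \<phi> i j) = \<phi> 1 1 * (real k - 1)"
    using assms(6) by blast
  case 1
  show ?case
  proof (intro allI impI, elim conjE)
    fix N and \<rho>\<^sub>r :: "nat \<Rightarrow> (nat \<Rightarrow> nat) pmf" and w \<rho> and M :: "'w measure" and X
    assume N: "1 \<le> N" and sol: "layer_distributions N \<rho>\<^sub>r" "coag_balance a b \<psi> N \<rho>\<^sub>r" "frag_balance \<phi> N \<rho>\<^sub>r"
      and w: "set_pmf w \<subseteq> {1..N}"
      and \<rho>: "\<forall>r\<in>{1..N}. \<forall>\<eta>\<in>Omega_groups N r. pmf \<rho> \<eta> = pmf w r * pmf (\<rho>\<^sub>r r) \<eta>"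
      and X: "is_cfp M N \<psi> \<phi> \<rho> X"
    interpret lumping "Omega N" "{1..N}" "groups N" "cfp_rate N \<psi> \<phi>"
        "birth_death_rate (lambda \<phi> N) (mu a b N)" \<rho>\<^sub>r
      by (rule cfp_lumping[OF N \<psi> \<phi> sol])
    have chain: "markov_chain M (Omega N) (cfp_rate N \<psi> \<phi>) \<rho> X"
      using X by (simp only: is_cfp_def)
    have \<rho>': "pmf \<rho> \<eta> = pmf w (groups N \<eta>) * pmf (\<rho>\<^sub>r (groups N \<eta>)) \<eta>" if "\<eta> \<in> Omega N" for \<eta>
      using \<rho> g_T[OF that] that by (simp add: Omega_groups_def)
    show "(\<forall>r\<in>{1..N}. \<forall>\<eta>\<in>Omega_groups N r. \<forall>t\<ge>0.
             \<P>(\<omega> in M. X t \<omega> = \<eta>) = pmf (\<rho>\<^sub>r r) \<eta> * \<P>(\<omega> in M. groups N (X t \<omega>) = r)) \<and>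
          markov_chain M {1..N} (birth_death_rate (lambda \<phi> N) (mu a b N)) w
            (\<lambda>t \<omega>. groups N (X t \<omega>))"
    proof (intro conjI ballI allI impI)
      fix r \<eta> and t :: real assume "\<eta> \<in> Omega_groups N r" "0 \<le> t"
      then show "\<P>(\<omega> in M. X t \<omega> = \<eta>) = pmf (\<rho>\<^sub>r r) \<eta> * \<P>(\<omega> in M. groups N (X t \<omega>) = r)"
        using lumped_markov_chain(1)[OF chain w \<rho>', of t \<eta>] by (simp add: Omega_groups_def)
    qed (rule lumped_markov_chain(2)[OF chain w \<rho>'])
  qed
next
  case 2
  show ?case
  proof (intro allI impI, elim conjE)
    fix N \<rho>\<^sub>r
    assume pos: "\<forall>i\<ge>1. \<forall>j\<ge>1. 0 < \<psi> i j" and N: "1 \<le> N"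
      and sol: "layer_distributions N \<rho>\<^sub>r" "coag_balance a b \<psi> N \<rho>\<^sub>r"
    \<comment> \<open>The smallest pair i = j = 1 turns positivity of the rates into 2 a + b >
      0.\<close>
    have "\<psi> 1 1 = a * (real 1 + real 1) + b" using assms(5) by blast
    moreover have "0 < \<psi> 1 1" using pos by blast
    ultimately have "0 < 2 * a + b" by simp
    then show "gibbs_layers a b N \<rho>\<^sub>r"
      using assms(1) N assms(5) sol by (intro gibbs_layers_if_coag_balance)
  qed
next
  case 3
  show ?case
  proof (intro allI impI, elim conjE)
    fix a' b' :: real
    assume c: "0 < \<phi> 1 1" and a': "0 \<le> a'" and ab': "0 < 2 * a' + b'"
    have \<phi>: "\<And>k. 1 \<le> k \<Longrightarrow> (\<Sum>(i, j)\<in>{(i, j). 1 \<le> i \<and> i \<le> j \<and> i + j = k}. \<phi> i j) = \<phi> 1 1 * (real k - 1)"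
      using assms(6) by blast
    have nonneg: "\<forall>i\<ge>1. \<forall>j\<ge>1. 0 \<le> \<phi> i j" using assms(4) by blast
    have "(\<forall>N\<ge>1. \<forall>\<rho>\<^sub>r. layer_distributions N \<rho>\<^sub>r \<and> frag_balance \<phi> N \<rho>\<^sub>r \<longrightarrow> gibbs_layers a' b' N \<rho>\<^sub>r)
      \<longleftrightarrow> (\<forall>i j. 1 \<le> i \<longrightarrow> i \<le> j \<longrightarrow> \<phi> i j = \<phi> 1 1 * gibbs_frag a' b' i j)" (is "?G \<longleftrightarrow> ?F")
    proof
      assume G: ?G
      show ?F
      proof (intro allI impI)
        fix i j :: nat assume ij: "1 \<le> i" "i \<le> j"
        then have "1 \<le> i + j" by simp
        then show "\<phi> i j = \<phi> 1 1 * gibbs_frag a' b' i j"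
          using G by (intro frag_rates_if_gibbs_layers[OF a' ab' c nonneg \<phi> ij]) blast+
      qed
    next
      assume ?F
      then show ?G
        using gibbs_layers_if_frag_balance[where \<phi> = \<phi>, OF a' ab' _ c] by blast
    qed
    then show "(\<forall>N\<ge>1. \<forall>\<rho>\<^sub>r. layer_distributions N \<rho>\<^sub>r \<and> frag_balance \<phi> N \<rho>\<^sub>r \<longrightarrow> gibbs_layers a' b' N \<rho>\<^sub>r)
      \<longleftrightarrow>
      ((\<forall>i\<ge>1. \<forall>j\<ge>1. i \<noteq> j \<longrightarrow>
               \<phi> i j = \<phi> 1 1 * (gibbs_weight a' b' i * gibbs_weight a' b' j / gibbs_weight a' b' (i + j))
                       * (a' * (real i + real j) + b')) \<and>
            (\<forall>i\<ge>1.
               \<phi> i i = \<phi> 1 1 * ((gibbs_weight a' b' i)\<^sup>2 / (2 * gibbs_weight a' b' (2 * i)))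
                       * (2 * a' * real i + b')))"
      unfolding gibbs_frag_iff[OF assms(4)] .
  qed
qed

end
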